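(* In the two-slope ski rental problem with tail constraint $(\gamma,\delta)$ described in the context, suppose $0\le\delta<\frac{\mathrm{OPT}-1}{\frac1a-1}$. Then (1) the optimal solution is not unique; and (2) the point $L_b=\frac{\gamma-1}{1-a\gamma}$ satisfies $L_b\ge1$, and every optimal solution $f$ places exactly $\delta$ mass in $(L_b,\infty]$.
   Context: Fix $0\le a<1$ and $(\gamma,\delta)$ with $2-a\le\gamma<1/a$, $0\le\delta\le1$. A purchase distribution $f$ is a probability distribution on $[0,\infty)\cup\{\infty\}$ (buying time; $\infty$ = never buy). For buying time $t$ and stopping time $x>0$: $\alpha(t,x)=\frac{t+1-a+a(x-t)}{x}$ if $t\le x\le1$; $1$ if $t>x$, $x\le1$; $\frac{t+1-a+a(x-t)}{1-a+ax}$ if $t\le x$, $x>1$; $\frac{x}{1-a+ax}$ if $t>x$, $x>1$ (incl. $t=\infty$); $\alpha(t,\infty)=1$ for finite $t$, $\alpha(\infty,\infty)=1/a$. $\alpha_f(x)=\mathbb{E}_{t\sim f}\alpha(t,x)$. Bad interval $I_\gamma(x)=\{t:\alpha(t,x)>\gamma\}$; $f$ is feasible if $f(I_\gamma(x))\le\delta$ for all $x\in(0,\infty]$. $\mathrm{OPT}=\min_{f\text{ feasible}}\sup_x\alpha_f(x)$; an optimal solution is a feasible $f$ attaining it.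
   Formalization: Non-uniqueness (1) is claimed only for δ > 0; at δ = 0 it is false (e.g. γ = 2−a leaves only the point mass at 1 feasible), so there only existence of an optimal solution is stated; (2) is claimed for all δ ≥ 0. *)

theory Defs
  imports "HOL-Probability.Probability"
begin

text \<open>
  Times and ratios both live in \<^typ>\<open>ennreal\<close>, i.e. in $[0,\infty]$; the buying time
  \<^term>\<open>\<top> :: ennreal\<close> means that the skier never buys. For \<^term>\<open>a = (0 :: real)\<close> the
  quotient \<^term>\<open>1 / ennreal a\<close> is \<^term>\<open>\<top> :: ennreal\<close>, as intended.
  Differences of times are only formed when the subtrahend is at most the minuend.
\<close>

definition ratio :: "real \<Rightarrow> ennreal \<Rightarrow> ennreal \<Rightarrow> ennreal" where
  "ratio a t x =
     (if x = \<top> then (if t = \<top> then 1 / ennreal a else 1)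
      else if x \<le> 1 then
        (if t \<le> x then (t + ennreal (1 - a) + ennreal a * (x - t)) / x else 1)
      else
        (if t \<le> x then (t + ennreal (1 - a) + ennreal a * (x - t)) / (ennreal (1 - a) + ennreal a * x)
         else x / (ennreal (1 - a) + ennreal a * x)))"

definition expected_ratio :: "real \<Rightarrow> ennreal measure \<Rightarrow> ennreal \<Rightarrow> ennreal" where
  "expected_ratio a f x = (\<integral>\<^sup>+ t. ratio a t x \<partial>f)"

definition worst_ratio :: "real \<Rightarrow> ennreal measure \<Rightarrow> ennreal" where
  "worst_ratio a f = (SUP x \<in> {0<..}. expected_ratio a f x)"

definition bad_interval :: "real \<Rightarrow> real \<Rightarrow> ennreal \<Rightarrow> ennreal set" where
  "bad_interval a \<gamma> x = {t. ratio a t x > ennreal \<gamma>}"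

definition purchase_distribution :: "ennreal measure \<Rightarrow> bool" where
  "purchase_distribution f \<longleftrightarrow> prob_space f \<and> sets f = sets borel"

definition feasible :: "real \<Rightarrow> real \<Rightarrow> real \<Rightarrow> ennreal measure \<Rightarrow> bool" where
  "feasible a \<gamma> \<delta> f \<longleftrightarrow>
     purchase_distribution f \<and> (\<forall>x>0. measure f (bad_interval a \<gamma> x) \<le> \<delta>)"

definition OPT :: "real \<Rightarrow> real \<Rightarrow> real \<Rightarrow> ennreal" where
  "OPT a \<gamma> \<delta> = (INF f \<in> {f. feasible a \<gamma> \<delta> f}. worst_ratio a f)"

definition optimal :: "real \<Rightarrow> real \<Rightarrow> real \<Rightarrow> ennreal measure \<Rightarrow> bool" where
  "optimal a \<gamma> \<delta> f \<longleftrightarrow> feasible a \<gamma> \<delta> f \<and> worst_ratio a f = OPT a \<gamma> \<delta>"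

definition L\<^sub>b :: "real \<Rightarrow> real \<Rightarrow> real" where
  "L\<^sub>b a \<gamma> = (\<gamma> - 1) / (1 - a * \<gamma>)"

end

theory Submission
  imports Defs
begin

text \<open>
  Write $G(x)$ for the probability of buying after time $x$, $H(x) = \int_0^x G$ and $d(x)$ for the
  offline cost $\min(x, 1 - a + ax)$. Then $\alpha_f(x) \le r$ is the inequality $H(x) - q_r(x) \le G(x)$
  with the piecewise linear barrier $q_r(x) = (r\,d(x) - ax)/(1 - a) - 1$, and for $x \le 1 + L_b$ the bad
  interval of $x$ is $(q_\gamma(x), x]$, while the later ones exhaust $(L_b, \infty]$. Helly's selection
  theorem yields an optimal $G$. The hypothesis says that the slope $\kappa = (\mathrm{OPT} - 1)a/(1 - a)$ of
  $q_{\mathrm{OPT}}$ beyond time 1 exceeds $\delta$. Hence replacing $G$ by $\max(G, \delta)$ stays optimal,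
  and so does afterwards buying the last $\delta$ at a large finite time: optima are not unique.

  If an optimal $G$ had $G(L_b) < \delta$, then for some $\theta$ just below $\kappa$ the function
  $\max(G, \theta)$ would have uniform slack beyond time 1, since a constraint binding at level $\kappa$
  would force $G \ge \kappa$ forever. Mixing in a little of never buying gains before time 1 too, and a small
  multiple of the result can be mixed into $G$ without violating the tail constraint, lowering the ratio.
\<close>

section \<open>Survival functions and their integrals\<close>

text \<open>The limit at infinity may be positive: it is the probability of never buying. Negative
  arguments carry the value 1 because the barriers below start at -1; a jump at 0 is the mass that
  buys at once.\<close>

definition is_survival :: "(real \<Rightarrow> real) \<Rightarrow> bool" where
  "is_survival G \<longleftrightarrow>
     antimono G \<and> (\<forall>x. continuous (at_right x) G) \<and> (\<forall>x<0. G x = 1) \<and> (\<forall>x. 0 \<le> G x)"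

text \<open>This is the expected buying time capped at \<open>x\<close>; see
  \<open>nn_integral_min_eq_area\<close>.\<close>

definition area :: "(real \<Rightarrow> real) \<Rightarrow> real \<Rightarrow> real" where
  "area G x = (LINT s:{0..<x}|lborel. G s)"

lemma survival_antimono: "is_survival G \<Longrightarrow> x \<le> y \<Longrightarrow> G y \<le> G x"
  by (simp add: is_survival_def antimono_def)

lemma survival_nonneg: "is_survival G \<Longrightarrow> 0 \<le> G x"
  by (simp add: is_survival_def)

lemma survival_neg: "is_survival G \<Longrightarrow> x < 0 \<Longrightarrow> G x = 1"
  by (simp add: is_survival_def)

lemma survival_le_1: "is_survival G \<Longrightarrow> G x \<le> 1"
  using survival_antimono[of G "- \<bar>x\<bar> - 1" x] survival_neg[of G "- \<bar>x\<bar> - 1"] by auto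

lemma survival_right_tendsto: "is_survival G \<Longrightarrow> (G \<longlongrightarrow> G x) (at_right x)"
  by (simp add: is_survival_def continuous_within)

lemma survival_measurable: "is_survival G \<Longrightarrow> G \<in> borel_measurable borel"
proof -
  assume G: "is_survival G"
  have "mono (\<lambda>x. - G x)"
    using survival_antimono[OF G] by (simp add: mono_def)
  then have "(\<lambda>x. - G x) \<in> borel_measurable borel"
    by (rule borel_measurable_mono)
  then have "(\<lambda>x. - (- G x)) \<in> borel_measurable borel"
    by (rule borel_measurable_uminus)
  then show ?thesis by simp
qed

lemma set_integrable_const_Ico: "set_integrable lborel {x..<y :: real} (\<lambda>_. c :: real)"
  unfolding set_integrable_def
  by (cases "x \<le> y") (intro integrable_scaleR_left integrable_real_indicator; simp)+

lemma survival_set_integrable: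
  assumes "is_survival G"
  shows "set_integrable lborel {x..<y} G"
proof (rule set_integrable_bound)
  show "set_integrable lborel {x..<y} (\<lambda>_. 1 :: real)"
    by (rule set_integrable_const_Ico)
  show "set_borel_measurable lborel {x..<y} G"
    using survival_measurable[OF assms] unfolding set_borel_measurable_def by measurable
  show "AE s in lborel. s \<in> {x..<y} \<longrightarrow> norm (G s) \<le> norm (1 :: real)"
    using survival_le_1[OF assms] survival_nonneg[OF assms] by simp
qed

lemma set_integral_const_Ico: "x \<le> y \<Longrightarrow> (LINT s:{x..<y}|lborel. (c :: real)) = c * (y - x)"
  by (simp add: set_lebesgue_integral_def)

lemma area_diff:
  assumes "is_survival G" "0 \<le> x" "x \<le> y"
  shows "area G y - area G x = (LINT s:{x..<y}|lborel. G s)"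
proof -
  have "{0..<y} = {0..<x} \<union> {x..<y}" using assms by auto
  then show ?thesis unfolding area_def
    using set_integral_Un[of "{0..<x}" "{x..<y}" lborel G] survival_set_integrable[OF assms(1)] by auto
qed

lemma area_0 [simp]: "area G 0 = 0"
  by (simp add: area_def set_lebesgue_integral_def)

lemma area_diff_ge:
  assumes "is_survival G" "0 \<le> x" "x \<le> y" "\<And>s. x \<le> s \<Longrightarrow> s < y \<Longrightarrow> g \<le> G s"
  shows "g * (y - x) \<le> area G y - area G x"
proof -
  have "(LINT s:{x..<y}|lborel. g) \<le> (LINT s:{x..<y}|lborel. G s)"
    by (intro set_integral_mono set_integrable_const_Ico survival_set_integrable) (use assms in auto)
  then show ?thesis using assms by (simp add: area_diff set_integral_const_Ico)
qed

lemma area_diff_le: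
  assumes "is_survival G" "0 \<le> x" "x \<le> y" "\<And>s. x \<le> s \<Longrightarrow> s < y \<Longrightarrow> G s \<le> g"
  shows "area G y - area G x \<le> g * (y - x)"
proof -
  have "(LINT s:{x..<y}|lborel. G s) \<le> (LINT s:{x..<y}|lborel. g)"
    by (intro set_integral_mono set_integrable_const_Ico survival_set_integrable) (use assms in auto)
  then show ?thesis using assms by (simp add: area_diff set_integral_const_Ico)
qed

lemma area_mono:
  assumes "is_survival G" "is_survival K" "\<And>s. 0 \<le> s \<Longrightarrow> s < x \<Longrightarrow> G s \<le> K s"
  shows "area G x \<le> area K x"
  unfolding area_def
  by (intro set_integral_mono survival_set_integrable) (use assms in auto)

lemma area_cong:
  assumes "\<And>s. 0 \<le> s \<Longrightarrow> s < x \<Longrightarrow> G s = K s"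
  shows "area G x = area K x"
  unfolding area_def by (intro set_lebesgue_integral_cong) (use assms in auto)

lemma area_mix:
  assumes "is_survival G" "is_survival K"
  shows "area (\<lambda>s. p * G s + q * K s) x = p * area G x + q * area K x"
  unfolding area_def using survival_set_integrable[OF assms(1)] survival_set_integrable[OF assms(2)]
  by (subst set_integral_add) auto

lemma area_le: "is_survival G \<Longrightarrow> 0 \<le> x \<Longrightarrow> area G x \<le> x"
  using area_diff_le[of G 0 x 1] survival_le_1 by simp

lemma area_nonneg: "is_survival G \<Longrightarrow> 0 \<le> x \<Longrightarrow> 0 \<le> area G x"
  using area_diff_ge[of G 0 x 0] survival_nonneg by simp

lemma survival_const_1: "is_survival (\<lambda>_. 1)"
  by (simp add: is_survival_def antimono_def)

lemma area_const: "0 \<le> x \<Longrightarrow> area (\<lambda>_. c) x = c * x"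
  by (simp add: area_def set_integral_const_Ico)

lemma survival_mix:
  assumes "is_survival G" "is_survival K" "0 \<le> p" "0 \<le> q" "p + q = 1"
  shows "is_survival (\<lambda>s. p * G s + q * K s)"
  using assms unfolding is_survival_def antimono_def
  by (auto intro!: continuous_intros add_mono mult_left_mono)

text \<open>Taking the maximum with \<open>\<theta>\<close> turns the latest \<open>\<theta>\<close>
  of the purchases into never buying. The bound \<open>\<theta> \<le> 1\<close> keeps the value 1 at
  negative times.\<close>

lemma survival_max:
  assumes "is_survival G" "\<theta> \<le> 1"
  shows "is_survival (\<lambda>s. max (G s) \<theta>)"
proof -
  have "max (G y) \<theta> \<le> max (G x) \<theta>" if "x \<le> y" for x y
    using survival_antimono[OF assms(1) that] by auto
  moreover have "continuous (at_right x) (\<lambda>s. max (G s) \<theta>)" for x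
    using survival_right_tendsto[OF assms(1)] unfolding continuous_within
    by (intro tendsto_max tendsto_const)
  ultimately show ?thesis
    using assms survival_nonneg[OF assms(1)] unfolding is_survival_def antimono_def
    by (auto simp: le_max_iff_disj)
qed

text \<open>All purchases planned after \<open>T\<close>, never buying included, are moved to
  \<open>T\<close>.\<close>

lemma survival_cut:
  assumes "is_survival G" "0 \<le> T"
  shows "is_survival (\<lambda>s. if s < T then G s else 0)"
  unfolding is_survival_def
proof (intro conjI allI impI)
  show "antimono (\<lambda>s. if s < T then G s else 0)"
    using assms survival_antimono survival_nonneg by (auto simp: antimono_def)
  fix x :: real
  show "x < 0 \<Longrightarrow> (if x < T then G x else 0) = 1" "0 \<le> (if x < T then G x else 0)"
    using assms survival_neg survival_nonneg by auto
  show "continuous (at_right x) (\<lambda>s. if s < T then G s else 0)"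
  proof (cases "x < T")
    case True
    have "eventually (\<lambda>s. s < T) (at_right x)"
      using True by (auto simp: eventually_at_right_field intro!: exI[of _ T])
    then have "((\<lambda>s. if s < T then G s else 0) \<longlongrightarrow> G x) (at_right x)"
      by (intro Lim_transform_eventually[OF survival_right_tendsto[OF assms(1)]])
        (auto elim!: eventually_mono)
    then show ?thesis using True by (simp add: continuous_within)
  next
    case False
    have "eventually (\<lambda>s. x < s) (at_right x)" by (simp add: eventually_at_right_less)
    then have "((\<lambda>s. if s < T then G s else 0) \<longlongrightarrow> 0) (at_right x)"
      by (intro Lim_transform_eventually[OF tendsto_const]) (use False in \<open>auto elim!: eventually_mono\<close>)
    then show ?thesis using False by (simp add: continuous_within)
  qed
qed

text \<open>By right-continuity the infimum of the times at level \<open>\<theta>\<close> or below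
  is itself such a time.\<close>

lemma survival_hitting_point:
  assumes G: "is_survival G" and w: "0 \<le> w" "G w \<le> \<theta>" "0 \<le> x0" "x0 \<le> w"
  obtains y where "x0 \<le> y" "y \<le> w" "G y \<le> \<theta>" "\<And>s. x0 \<le> s \<Longrightarrow> s < y \<Longrightarrow> \<theta> < G s"
proof -
  define A where "A = {s. x0 \<le> s \<and> G s \<le> \<theta>}"
  define y where "y = Inf A"
  have ne: "A \<noteq> {}" and bdd: "bdd_below A" using w by (auto simp: A_def intro: bdd_belowI[of _ x0])
  have 1: "x0 \<le> y" unfolding y_def using ne by (intro cInf_greatest) (auto simp: A_def)
  have 2: "y \<le> w" unfolding y_def using bdd w by (intro cInf_lower) (auto simp: A_def)
  have 3: "\<theta> < G s" if "x0 \<le> s" "s < y" for s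
    using that cInf_lower[OF _ bdd, of s] by (force simp: A_def y_def)
  have "G s \<le> \<theta>" if "y < s" for s
  proof -
    obtain u where "u \<in> A" "u < s" using cInf_lessD[OF ne, of s] \<open>y < s\<close> unfolding y_def by blast
    then show ?thesis using survival_antimono[OF G, of u s] by (auto simp: A_def)
  qed
  then have "eventually (\<lambda>s. G s \<le> \<theta>) (at_right y)"
    by (auto simp: eventually_at_right_field intro!: exI[of _ "y + 1"])
  then have "G y \<le> \<theta>"
    by (intro tendsto_upperbound[OF survival_right_tendsto[OF G]]) auto
  then show ?thesis using that 1 2 3 by blast
qed

lemma survival_countable_discont:
  assumes "is_survival G"
  shows "countable {s. \<not> isCont G s}"
proof -
  have "mono (\<lambda>s. - G s)"
    using survival_antimono[OF assms] by (simp add: mono_def)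
  then have "countable {s. \<not> isCont (\<lambda>s. - G s) s}"
    by (rule mono_ctble_discont)
  moreover have "isCont (\<lambda>s. - G s) s \<longleftrightarrow> isCont G s" for s
    using continuous_minus[of "at s" G] continuous_minus[of "at s" "\<lambda>s. - G s"] by auto
  ultimately show ?thesis by simp
qed

text \<open>A monotone limit has only countably many discontinuities, so convergence holds almost
  everywhere, and dominated convergence applies.\<close>

lemma area_tendsto:
  assumes "\<And>n. is_survival (G n)" "is_survival K" "\<And>x. isCont K x \<Longrightarrow> (\<lambda>n. G n x) \<longlonglongrightarrow> K x"
  shows "(\<lambda>n. area (G n) x) \<longlonglongrightarrow> area K x"
  unfolding area_def set_lebesgue_integral_def
proof (rule integral_dominated_convergence)
  show "integrable lborel (\<lambda>s. indicator {0..<x} s :: real)"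
    using set_integrable_const_Ico[of 0 x 1] by (simp add: set_integrable_def)
  show "(\<lambda>s. indicator {0..<x} s *\<^sub>R K s) \<in> borel_measurable lborel"
    using survival_measurable[OF assms(2)] by measurable
  show "(\<lambda>s. indicator {0..<x} s *\<^sub>R G n s) \<in> borel_measurable lborel" for n
    using survival_measurable[OF assms(1)] by measurable
  show "AE s in lborel. norm (indicator {0..<x} s *\<^sub>R G n s) \<le> indicator {0..<x} s" for n
    using survival_nonneg[OF assms(1)] survival_le_1[OF assms(1)] by (auto simp: indicator_def)
  have "{s. \<not> isCont K s} \<in> null_sets lborel"
    by (intro countable_imp_null_set_lborel survival_countable_discont assms(2))
  then have "AE s in lborel. isCont K s"
    by (rule AE_I') auto
  then show "AE s in lborel. (\<lambda>n. indicator {0..<x} s *\<^sub>R G n s) \<longlonglongrightarrow> indicator {0..<x} s *\<^sub>R K s"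
    by eventually_elim (intro tendsto_intros assms(3))
qed

section \<open>Piecewise linear barriers and the constraints on survival functions\<close>

text \<open>\<open>barrier\<close> serves both as the ratio bound $q_r$ and as the left end $q_\gamma$ of the bad intervals.\<close>
definition den :: "real \<Rightarrow> real \<Rightarrow> real" where
  "den a x = (if x \<le> 1 then x else 1 - a + a * x)"

definition barrier :: "real \<Rightarrow> real \<Rightarrow> real \<Rightarrow> real" where
  "barrier a r x = (r * den a x - a * x) / (1 - a) - 1"

text \<open>Only finite stopping times appear; the constraint at \<top> follows from them, as
  \<open>worst_ratio_le_iff\<close> shows.\<close>

definition ratio_ok :: "real \<Rightarrow> real \<Rightarrow> (real \<Rightarrow> real) \<Rightarrow> bool" where
  "ratio_ok a r G \<longleftrightarrow> (\<forall>x>0. area G x - barrier a r x \<le> G x)"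

text \<open>The drop of \<open>G\<close> from the barrier to \<open>x\<close> is the mass of the bad
  interval \<open>(barrier a \<gamma> x, x]\<close>; a negative barrier gives the value 1 and so
  includes time 0. The second clause collects the half-lines that are bad for late stopping
  times.\<close>

definition tail_ok :: "real \<Rightarrow> real \<Rightarrow> real \<Rightarrow> (real \<Rightarrow> real) \<Rightarrow> bool" where
  "tail_ok a \<gamma> \<delta> G \<longleftrightarrow>
     (\<forall>x>0. G (barrier a \<gamma> x) - G x \<le> \<delta>) \<and> G (L\<^sub>b a \<gamma>) \<le> \<delta>"

definition admissible :: "real \<Rightarrow> real \<Rightarrow> real \<Rightarrow> real \<Rightarrow> (real \<Rightarrow> real) \<Rightarrow> bool" where
  "admissible a \<gamma> \<delta> r G \<longleftrightarrow> is_survival G \<and> ratio_ok a r G \<and> tail_ok a \<gamma> \<delta> G"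

lemma barrier_le_1: "x \<le> 1 \<Longrightarrow> barrier a r x = (r - a) / (1 - a) * x - 1"
  by (simp add: barrier_def den_def algebra_simps)

lemma barrier_ge_1: "a < 1 \<Longrightarrow> 1 \<le> x \<Longrightarrow> barrier a r x = r - 1 + (r - 1) * a / (1 - a) * x"
  by (cases "x = 1") (auto simp: barrier_def den_def field_simps)

lemma barrier_diff_ge_1:
  "a < 1 \<Longrightarrow> 1 \<le> x \<Longrightarrow> 1 \<le> y \<Longrightarrow>
    barrier a r y - barrier a r x = (r - 1) * a / (1 - a) * (y - x)"
  by (simp add: barrier_ge_1 right_diff_distrib)

text \<open>With \<open>c = (r - 1) / (1 - a)\<close> the slope is \<open>1 + c\<close> before time
  1 and \<open>c * a\<close> afterwards; the later one is smaller and bounds every increment from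
  below.\<close>

lemma barrier_mono:
  assumes "0 < a" "a < 1" "1 \<le> r" "x \<le> y"
  shows "(r - 1) * a / (1 - a) * (y - x) \<le> barrier a r y - barrier a r x"
proof -
  define c where "c = (r - 1) / (1 - a)"
  have c: "0 \<le> c" "c * a \<le> c" "(r - 1) * a / (1 - a) = c * a"
    using assms mult_left_le[of a "(r - 1) / (1 - a)"] by (simp_all add: c_def)
  have "(r - a) / (1 - a) = 1 + c" using assms by (simp add: c_def field_simps)
  then have le1: "barrier a r z = (1 + c) * z - 1" if "z \<le> 1" for z
    using that by (simp add: barrier_le_1)
  have "r - 1 = c * (1 - a)" using assms by (simp add: c_def)
  then have ge1: "barrier a r z = c * (1 - a) + c * a * z" if "1 \<le> z" for z
    using that assms c by (simp add: barrier_ge_1)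
  have low: "c * a * (v - u) \<le> barrier a r v - barrier a r u" if "u \<le> v" "v \<le> 1" for u v
  proof -
    have "c * a * (v - u) \<le> (1 + c) * (v - u)" using c that by (intro mult_right_mono) auto
    then show ?thesis using that by (simp add: le1 algebra_simps)
  qed
  have high: "c * a * (v - u) = barrier a r v - barrier a r u" if "u \<le> v" "1 \<le> u" for u v
    using that by (simp add: ge1 algebra_simps)
  consider "y \<le> 1" | "1 \<le> x" | "x < 1" "1 < y" by linarith
  then show ?thesis
  proof cases
    case 3
    then show ?thesis using low[of x 1] high[of 1 y] unfolding c by (simp add: algebra_simps)
  qed (use low[of x y] high[of x y] assms c in auto)
qed

lemma barrier_mono_small:
  assumes "0 < a" "a < 1" "1 \<le> r" "x \<le> y" "y \<le> 1"
  shows "y - x \<le> barrier a r y - barrier a r x"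
proof -
  have "1 \<le> (r - a) / (1 - a)" using assms by (simp add: field_simps)
  then have "1 * (y - x) \<le> (r - a) / (1 - a) * (y - x)" using assms by (intro mult_right_mono) auto
  then show ?thesis using assms by (simp add: barrier_le_1 right_diff_distrib)
qed

lemma barrier_0: "barrier a r 0 = - 1"
  by (simp add: barrier_def den_def)

text \<open>The barrier tends to -1 at 0, so an adversary stopping almost immediately leaves no room
  for a purchase at time 0.\<close>

lemma ratio_ok_0:
  assumes "is_survival G" "ratio_ok a r G"
  shows "G 0 = 1"
proof -
  have "\<forall>\<^sub>F x in at_right (0::real). 0 < x \<and> x < 1"
    by (auto simp: eventually_at_right_field intro!: exI[of _ 1])
  then have "\<forall>\<^sub>F x in at_right 0. - ((r - a) / (1 - a) * x - 1) \<le> G x"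
  proof eventually_elim
    case (elim x)
    then show ?case
      using assms(2)[unfolded ratio_ok_def, rule_format, of x] area_nonneg[OF assms(1), of x]
        barrier_le_1[of x a r] by simp
  qed
  moreover have "((\<lambda>x. - ((r - a) / (1 - a) * x - 1)) \<longlongrightarrow> - ((r - a) / (1 - a) * 0 - 1)) (at_right 0)"
    by (intro tendsto_intros)
  ultimately have "- ((r - a) / (1 - a) * 0 - 1) \<le> G 0"
    by (intro tendsto_le[OF trivial_limit_at_right_real survival_right_tendsto[OF assms(1), of 0]])
  then show ?thesis using survival_le_1[OF assms(1), of 0] by simp
qed

text \<open>From the first time \<open>y\<close> with \<open>G y \<le> \<theta>\<close> on, the
  truncated function is constantly \<open>\<theta>\<close>, so its integral grows no faster than the
  barrier, whose slope never falls below \<open>(r - 1) * a / (1 - a)\<close>. The inequality at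
  \<open>y\<close> therefore persists.\<close>

lemma ratio_ok_max:
  assumes a: "0 < a" "a < 1" and r: "1 \<le> r"
    and G: "is_survival G" "ratio_ok a r G"
    and w: "0 \<le> w" "G w \<le> \<theta>" and \<theta>: "\<theta> \<le> 1" "\<theta> \<le> (r - 1) * a / (1 - a)"
  shows "ratio_ok a r (\<lambda>s. max (G s) \<theta>)"
proof -
  let ?K = "\<lambda>s. max (G s) \<theta>"
  note K = survival_max[OF G(1) \<theta>(1)]
  obtain y where y: "0 \<le> y" "G y \<le> \<theta>" "\<And>s. 0 \<le> s \<Longrightarrow> s < y \<Longrightarrow> \<theta> < G s"
    by (rule survival_hitting_point[OF G(1) w order_refl w(1)]) (rule that)
  show ?thesis unfolding ratio_ok_def
  proof (intro allI impI)
    fix x :: real assume x: "0 < x"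
    have 0: "area ?K z = area G z" if "z \<le> y" for z
      by (rule area_cong, rule max_absorb1, rule less_imp_le, rule y(3)) (use that in auto)
    show "area ?K x - barrier a r x \<le> ?K x"
    proof (cases "x < y")
      case True
      then show ?thesis
        using 0[of x] G(2)[unfolded ratio_ok_def, rule_format, OF x] by simp
    next
      case False
      have yle: "area G y - barrier a r y \<le> \<theta>"
      \<comment> \<open>\<open>ratio_ok\<close> says nothing at time 0, where instead
        \<open>G 0 = 1\<close> and the barrier is -1.\<close>
      proof (cases "y = 0")
        case True
        then show ?thesis using y(2) ratio_ok_0[OF G] by (simp add: barrier_0)
      next
        case False
        then show ?thesis
          using y(1,2) G(2)[unfolded ratio_ok_def, rule_format, of y] by simp
      qed
      have "G s \<le> \<theta>" if "y \<le> s" for s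
        using survival_antimono[OF G(1) that] y(2) by simp
      then have "area ?K x - area ?K y \<le> \<theta> * (x - y)"
        using False y(1) by (intro area_diff_le[OF K]) auto
      also have "\<dots> \<le> (r - 1) * a / (1 - a) * (x - y)"
        using False \<theta> by (intro mult_right_mono) auto
      also have "\<dots> \<le> barrier a r x - barrier a r y"
        using False by (intro barrier_mono[OF a r]) auto
      finally show ?thesis using yle 0[of y] by simp
    qed
  qed
qed

text \<open>Taking the maximum with a constant is monotone and 1-Lipschitz, so it does not enlarge
  drops.\<close>

lemma tail_ok_max:
  assumes "tail_ok a \<gamma> \<delta> G" "0 \<le> \<delta>" "\<theta> \<le> \<delta>"
  shows "tail_ok a \<gamma> \<delta> (\<lambda>s. max (G s) \<theta>)"
proof -
  have "max p \<theta> - max q \<theta> \<le> \<delta>" if "p - q \<le> \<delta>" for p q :: real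
    using that assms(2) by (auto simp: max_def)
  then show ?thesis using assms by (auto simp: tail_ok_def)
qed

text \<open>Discrete Gronwall: if \<open>H - q \<ge> \<kappa>\<close> at \<open>u\<close>, then \<open>G z \<ge> H z - q z \<ge> \<kappa> + (z - u) (G z - \<kappa>)\<close>
  for \<open>z \<le> u + 1/2\<close>, whence \<open>G z \<ge> \<kappa>\<close>; iterate.\<close>
lemma ratio_ok_tight:
  assumes a: "0 < a" "a < 1" and r: "1 \<le> r" and \<kappa>: "\<kappa> = (r - 1) * a / (1 - a)"
    and G: "is_survival G" "ratio_ok a r G"
    and y: "1 \<le> y" "\<kappa> \<le> area G y - barrier a r y"
  shows "\<kappa> \<le> G x"
proof -
  have step: "\<kappa> \<le> G z \<and> \<kappa> \<le> area G z - barrier a r z"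
    if u: "1 \<le> u" "\<kappa> \<le> area G u - barrier a r u" "u \<le> z" "z \<le> u + 1 / 2" for u z
  proof -
    have "G z * (z - u) \<le> area G z - area G u"
      using u by (intro area_diff_ge[OF G(1)] survival_antimono[OF G(1)]) auto
    moreover have "barrier a r z - barrier a r u = \<kappa> * (z - u)"
      using u a by (simp add: barrier_diff_ge_1 \<kappa>)
    ultimately have *: "\<kappa> + (G z - \<kappa>) * (z - u) \<le> area G z - barrier a r z"
      using u by (simp add: algebra_simps)
    moreover have "area G z - barrier a r z \<le> G z"
      using G(2) u by (simp add: ratio_ok_def)
    ultimately have "0 \<le> (G z - \<kappa>) * (1 - (z - u))" by (simp add: algebra_simps)
    then have "0 \<le> G z - \<kappa>" using u by (simp add: zero_le_mult_iff)
    moreover from this have "0 \<le> (G z - \<kappa>) * (z - u)" using u by simp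
    ultimately show ?thesis using * by linarith
  qed
  have n: "\<kappa> \<le> G (y + real n / 2) \<and> \<kappa> \<le> area G (y + real n / 2) - barrier a r (y + real n / 2)" for n
  proof (induction n)
    case 0
    show ?case using step[of y y] y by simp
  next
    case (Suc n)
    show ?case using step[of "y + real n / 2" "y + real (Suc n) / 2"] Suc y by (simp add: add_divide_distrib)
  qed
  obtain n where "2 * (x - y) \<le> real n" using real_arch_simple by blast
  then show ?thesis using n[of n] survival_antimono[OF G(1), of x "y + real n / 2"] by auto
qed

section \<open>Purchase distributions as survival functions\<close>

text \<open>For \<open>x < 0\<close> the value has to be forced, because \<^term>\<open>ennreal x\<close> is then 0 and would lose
  the mass at time 0.\<close>
definition survival :: "ennreal measure \<Rightarrow> real \<Rightarrow> real" where
  "survival f x = (if x < 0 then 1 else measure f {ennreal x<..})"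

lemma is_survival_survival:
  assumes "purchase_distribution f"
  shows "is_survival (survival f)"
proof -
  interpret prob_space f using assms by (simp add: purchase_distribution_def)
  have sets [measurable_cong]: "sets f = sets borel" using assms by (simp add: purchase_distribution_def)
  have anti: "survival f y \<le> survival f x" if "x \<le> y" for x y
  proof -
    have "{ennreal y<..} \<subseteq> {ennreal x<..}"
      using ennreal_leI[OF that] by simp
    then show ?thesis using that by (auto simp: survival_def intro!: finite_measure_mono)
  qed
  have cont: "continuous (at_right x) (survival f)" for x
  proof (cases "x < 0")
    case True
    have "(survival f \<longlongrightarrow> 1) (at_right x)"
    proof (rule tendsto_eventually)
      show "\<forall>\<^sub>F s in at_right x. survival f s = 1"
        using True by (auto simp: eventually_at_right_field survival_def intro!: exI[of _ 0])
    qed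
    then show ?thesis using True by (simp add: continuous_within survival_def)
  next
    case False
    \<comment> \<open>Right-continuity is continuity of the measure from below: these half-lines
      increase to \<open>{ennreal x<..}\<close>.\<close>
    let ?A = "\<lambda>n. {ennreal (x + 1 / real (Suc n))<..}"
    have "ennreal (x + 1 / real (Suc n)) \<le> ennreal (x + 1 / real (Suc m))" if "m \<le> n" for m n
      using that by (intro ennreal_leI add_left_mono divide_left_mono) auto
    then have inc: "incseq ?A"
      by (auto simp: incseq_def dest: order.strict_trans1)
    have "(\<Union>n. ?A n) = {ennreal x<..}"
    proof (intro equalityI subsetI)
      fix t assume "t \<in> (\<Union>n. ?A n)"
      then obtain n where "ennreal (x + 1 / real (Suc n)) < t" by auto
      moreover have "ennreal x \<le> ennreal (x + 1 / real (Suc n))" by (intro ennreal_leI) simp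
      ultimately show "t \<in> {ennreal x<..}" by (simp add: order.strict_trans1)
    next
      fix t assume "t \<in> {ennreal x<..}"
      then obtain z where z: "ennreal x < z" "z < t" using dense[of "ennreal x" t] by auto
      then obtain r where r: "0 \<le> r" "z = ennreal r" by (cases z) (auto simp: less_top[symmetric])
      then have "x < r" using z False by (simp add: ennreal_less_iff)
      then obtain n where "1 / real (Suc n) < r - x" using nat_approx_posE[of "r - x"] by auto
      then have "ennreal (x + 1 / real (Suc n)) \<le> ennreal r" by (intro ennreal_leI) simp
      then have "ennreal (x + 1 / real (Suc n)) < t" using z(2) r(2) order.strict_trans1 by blast
      then show "t \<in> (\<Union>n. ?A n)" by blast
    qed
    moreover have "survival f (x + 1 / real (Suc n)) = measure f (?A n)" for n
    proof -
      have "0 \<le> x + 1 / real (Suc n)" using False by (intro add_nonneg_nonneg) auto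
      then show ?thesis by (simp add: survival_def)
    qed
    moreover have "(\<lambda>n. measure f (?A n)) \<longlonglongrightarrow> measure f (\<Union>n. ?A n)"
      by (rule finite_Lim_measure_incseq[OF _ inc]) (auto simp: sets)
    ultimately have lim: "(\<lambda>n. survival f (x + 1 / real (Suc n))) \<longlonglongrightarrow> survival f x"
      using False by (simp add: survival_def)
    have "(survival f \<longlongrightarrow> survival f x) (at_right x)"
    proof (rule order_tendstoI)
      fix l assume "l < survival f x"
      then obtain n where n: "l < survival f (x + 1 / real (Suc n))"
        using order_tendstoD(1)[OF lim] by (auto simp: eventually_sequentially)
      have "l < survival f s" if "s < x + 1 / real (Suc n)" for s
        using n anti[of s "x + 1 / real (Suc n)"] that by linarith
      then show "\<forall>\<^sub>F s in at_right x. l < survival f s"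
        by (auto simp: eventually_at_right_field intro!: exI[of _ "x + 1 / real (Suc n)"])
    next
      fix l assume "survival f x < l"
      then have "survival f s < l" if "x < s" for s using anti[of x s] that by linarith
      then show "\<forall>\<^sub>F s in at_right x. survival f s < l"
        by (auto simp: eventually_at_right_field intro!: exI[of _ "x + 1"])
    qed
    then show ?thesis by (simp add: continuous_within)
  qed
  show ?thesis
    unfolding is_survival_def antimono_def using anti cont by (auto simp: survival_def)
qed

lemma survival_realised:
  assumes G: "is_survival G"
  obtains f where "purchase_distribution f" "survival f = G"
proof -
  \<comment> \<open>quantile transform of a uniform variable\<close>
  define Q where "Q u = (INF x \<in> {x. 0 \<le> x \<and> G x \<le> u}. ennreal x)" for u
  \<comment> \<open>Right-continuity makes the left inequality strict: \<open>u < G x\<close>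
    persists to some \<open>y > x\<close>, and \<open>Q u\<close> is at least \<open>y\<close>. If
    \<open>G\<close> never falls to \<open>u\<close>, the infimum over the empty set is \<top>, that
    is, never buying.\<close>
  have Q: "ennreal x < Q u \<longleftrightarrow> u < G x" if "0 \<le> x" for x u
  proof
    assume "ennreal x < Q u"
    then show "u < G x" using that unfolding Q_def
      by (metis (mono_tags, lifting) INF_lower leD le_less_linear mem_Collect_eq)
  next
    assume "u < G x"
    then have "\<forall>\<^sub>F s in at_right x. u < G s"
      by (rule order_tendstoD(1)[OF survival_right_tendsto[OF G]])
    then obtain b where b: "x < b" "\<And>s. x < s \<Longrightarrow> s < b \<Longrightarrow> u < G s"
      by (auto simp: eventually_at_right_field)
    define y where "y = (x + b) / 2"
    have y: "x < y" "u < G y" using b by (auto simp: y_def)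
    have "ennreal y \<le> Q u" unfolding Q_def
    proof (intro INF_greatest ennreal_leI)
      fix z assume "z \<in> {x. 0 \<le> x \<and> G x \<le> u}"
      then show "y \<le> z" using y survival_antimono[OF G, of z y] by force
    qed
    moreover have "ennreal x < ennreal y" using y that by (simp add: ennreal_less_iff)
    ultimately show "ennreal x < Q u" by (rule order.strict_trans2[rotated])
  qed
  have Q_meas [measurable]: "Q \<in> borel_measurable borel"
  proof (rule borel_measurableI_greater)
    fix t :: ennreal
    have "{u. t < Q u} \<in> sets borel"
    proof (cases t)
      case (real r)
      then have "{u. t < Q u} = {..<G r}" using Q by auto
      then show ?thesis by simp
    qed simp
    then show "{u \<in> space borel. t < Q u} \<in> sets borel" by simp
  qed
  define U where "U = uniform_measure lborel {0..<1 :: real}"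
  interpret U: prob_space U unfolding U_def by (rule prob_space_uniform_measure) auto
  define f where "f = distr U borel Q"
  have [measurable]: "Q \<in> borel_measurable U" using Q_meas by (simp add: U_def)
  have "purchase_distribution f"
    unfolding purchase_distribution_def f_def by (auto intro: U.prob_space_distr)
  moreover have "survival f = G"
  proof
    fix x show "survival f x = G x"
    proof (cases "x < 0")
      case True
      then show ?thesis using survival_neg[OF G] by (simp add: survival_def)
    next
      case False
      then have "Q -` {ennreal x<..} = {..<G x}" using Q by auto
      then have "measure f {ennreal x<..} = measure U {..<G x}"
        by (simp add: f_def measure_distr U_def)
      also have "\<dots> = measure lborel ({0..<1} \<inter> {..<G x})"
        unfolding U_def by (subst measure_uniform_measure) auto
      also have "{0..<1} \<inter> {..<G x} = {0..<G x}"
        using survival_le_1[OF G, of x] by auto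
      also have "measure lborel {0..<G x} = G x"
        using survival_nonneg[OF G, of x] by simp
      finally show ?thesis using False by (simp add: survival_def)
    qed
  qed
  ultimately show ?thesis by (rule that)
qed

text \<open>Layer cake: \<open>min t x\<close> is the length of the set of \<open>s\<close> in
  \<open>[0, x)\<close> with \<open>s < t\<close>; exchanging the integrals leaves the survival
  function.\<close>

lemma nn_integral_min_eq_area:
  assumes f: "purchase_distribution f" and x: "0 \<le> x"
  shows "(\<integral>\<^sup>+ t. min t (ennreal x) \<partial>f) = ennreal (area (survival f) x)"
proof -
  interpret prob_space f using f by (simp add: purchase_distribution_def)
  have sets [measurable_cong]: "sets f = sets borel" using f by (simp add: purchase_distribution_def)
  note S = is_survival_survival[OF f]
  interpret P: pair_sigma_finite lborel f ..
  let ?k = "\<lambda>s t. indicator {0..<x} s * indicator {ennreal s<..} t :: ennreal"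
  have "min t (ennreal x) = (\<integral>\<^sup>+ s. ?k s t \<partial>lborel)" for t
  proof -
    define y where "y = (if t = \<top> then x else min x (enn2real t))"
    have y: "0 \<le> y" "ennreal y = min t (ennreal x)"
      using x by (cases t; auto simp: y_def min_def ennreal_leI top_unique)+
    have "?k s t = indicator {0..<y} s" for s
      using x by (cases t) (auto simp: y_def indicator_def ennreal_less_iff)
    then have "(\<integral>\<^sup>+ s. ?k s t \<partial>lborel) = (\<integral>\<^sup>+ s. indicator {0..<y} s \<partial>lborel)" by simp
    also have "\<dots> = ennreal y" using y by simp
    finally show ?thesis using y by simp
  qed
  then have "(\<integral>\<^sup>+ t. min t (ennreal x) \<partial>f) = (\<integral>\<^sup>+ t. \<integral>\<^sup>+ s. ?k s t \<partial>lborel \<partial>f)" by simp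
  also have "\<dots> = (\<integral>\<^sup>+ s. \<integral>\<^sup>+ t. ?k s t \<partial>f \<partial>lborel)"
    by (rule P.Fubini') (simp add: indicator_def case_prod_beta)
  also have "\<dots> = (\<integral>\<^sup>+ s. ennreal (indicator {0..<x} s *\<^sub>R survival f s) \<partial>lborel)"
    by (intro nn_integral_cong)
      (auto simp: nn_integral_cmult emeasure_eq_measure survival_def sets split: split_indicator)
  also have "\<dots> = ennreal (area (survival f) x)"
    unfolding area_def set_lebesgue_integral_def
    using survival_set_integrable[OF S] survival_nonneg[OF S]
    by (intro nn_integral_eq_integral) (auto simp: set_integrable_def)
  finally show ?thesis .
qed

section \<open>The competitive ratio as a barrier inequality\<close>

lemma den_pos: "0 < a \<Longrightarrow> a < 1 \<Longrightarrow> 0 < x \<Longrightarrow> 0 < den a x"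
  by (simp add: den_def add_pos_pos)

lemma ratio_bought:
  assumes "0 < a" "a < 1" "0 < x" "0 \<le> r" "r \<le> x"
  shows "ratio a (ennreal r) (ennreal x) = ennreal ((r + 1 - a + a * (x - r)) / den a x)"
proof -
  have num: "ennreal r + ennreal (1 - a) + ennreal a * (ennreal x - ennreal r) =
      ennreal (r + 1 - a + a * (x - r))"
    using assms by (simp add: ennreal_minus ennreal_mult[symmetric] ennreal_plus[symmetric] algebra_simps del: ennreal_plus)
  have d: "ennreal (1 - a) + ennreal a * ennreal x = ennreal (1 - a + a * x)"
    using assms by (simp add: ennreal_mult[symmetric] ennreal_plus[symmetric] del: ennreal_plus)
  have "0 \<le> r + 1 - a + a * (x - r)" using assms by (intro add_nonneg_nonneg) (auto simp: algebra_simps)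
  moreover have "0 < 1 - a + a * x" using assms by (intro add_pos_pos) auto
  moreover have "ratio a (ennreal r) (ennreal x) =
      ennreal (r + 1 - a + a * (x - r)) / ennreal (den a x)"
    using assms unfolding ratio_def num d by (simp add: den_def ennreal_leI)
  moreover have "0 < den a x" using assms by (simp add: den_def add_pos_pos)
  ultimately show ?thesis by (simp only: divide_ennreal)
qed

lemma ratio_not_bought:
  assumes "0 < a" "a < 1" "0 < x" "ennreal x < t"
  shows "ratio a t (ennreal x) = ennreal (x / den a x)"
proof -
  have d: "ennreal (1 - a) + ennreal a * ennreal x = ennreal (1 - a + a * x)"
    using assms by (simp add: ennreal_mult[symmetric] ennreal_plus[symmetric] del: ennreal_plus)
  have pos: "0 < 1 - a + a * x" using assms by (intro add_pos_pos) auto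
  have "ratio a t (ennreal x) = (if x \<le> 1 then 1 else ennreal x / ennreal (1 - a + a * x))"
    using assms unfolding ratio_def d by (auto simp: not_le[symmetric])
  also have "\<dots> = ennreal (x / den a x)"
    using assms pos by (simp add: den_def divide_ennreal del: ennreal_plus)
  finally show ?thesis .
qed

text \<open>The ratio times \<open>den a x\<close> is the online cost. Buying at
  \<open>t \<le> x\<close> costs \<open>(1 - a) * t + (1 - a + a * x)\<close>; renting throughout
  costs \<open>x\<close>, which is that expression at \<open>t = x\<close> less
  \<open>1 - a\<close>. The subtracted term is moved across because \<open>ennreal\<close> truncates
  differences.\<close>

lemma ratio_balance:
  assumes "0 < a" "a < 1" "0 < x"
  shows "ennreal (den a x) * ratio a t (ennreal x) + ennreal (1 - a) * indicator {ennreal x<..} t =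
    ennreal (1 - a) * min t (ennreal x) + ennreal (1 - a + a * x)"
proof (cases "ennreal x < t")
  case True
  have "ennreal (den a x) * ratio a t (ennreal x) = ennreal x"
    using assms True den_pos[OF assms] by (simp add: ratio_not_bought ennreal_mult[symmetric])
  moreover have "min t (ennreal x) = ennreal x" using True by (simp add: min_absorb2 less_imp_le)
  moreover have "ennreal x + ennreal (1 - a) = ennreal (x + (1 - a))"
    using assms by (intro ennreal_plus[symmetric]) auto
  moreover have "ennreal (1 - a) * ennreal x + ennreal (1 - a + a * x) = ennreal ((1 - a) * x + (1 - a + a * x))"
    using assms by (simp add: ennreal_mult[symmetric] ennreal_plus[symmetric] del: ennreal_plus)
  moreover have "(1 - a) * x + (1 - a + a * x) = x + (1 - a)" by (simp add: algebra_simps)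
  ultimately show ?thesis using True by simp
next
  case False
  then obtain r where r: "0 \<le> r" "t = ennreal r" by (cases t) auto
  then have rx: "r \<le> x" using False assms by (simp add: ennreal_less_iff not_less)
  have "0 \<le> r + 1 - a + a * (x - r)" using assms r rx by (intro add_nonneg_nonneg) (auto simp: algebra_simps)
  then have "ennreal (den a x) * ratio a t (ennreal x) = ennreal (r + 1 - a + a * (x - r))"
    using assms r rx den_pos[OF assms] by (simp add: ratio_bought ennreal_mult[symmetric])
  moreover have "min t (ennreal x) = ennreal r" using rx r by (simp add: min_absorb1 ennreal_leI)
  moreover have "ennreal (1 - a) * ennreal r + ennreal (1 - a + a * x) = ennreal ((1 - a) * r + (1 - a + a * x))"
    using assms r by (simp add: ennreal_mult[symmetric] ennreal_plus[symmetric] del: ennreal_plus)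
  moreover have "(1 - a) * r + (1 - a + a * x) = r + 1 - a + a * (x - r)" by (simp add: algebra_simps)
  ultimately show ?thesis using False by simp
qed

lemma ratio_measurable [measurable]: "(\<lambda>t. ratio a t x) \<in> borel_measurable borel"
  unfolding ratio_def by measurable

text \<open>Integrating \<open>ratio_balance\<close> over \<open>f\<close> expresses the expected
  ratio through \<open>area\<close> and \<open>survival\<close>; dividing by \<open>1 - a\<close>
  produces the barrier.\<close>

lemma expected_ratio_le_iff:
  assumes a: "0 < a" "a < 1" and r: "0 \<le> r" and x: "0 < x" and f: "purchase_distribution f"
  shows "expected_ratio a f (ennreal x) \<le> ennreal r \<longleftrightarrow>
    area (survival f) x - barrier a r x \<le> survival f x"
proof -
  interpret prob_space f using f by (simp add: purchase_distribution_def)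
  have sets [measurable_cong]: "sets f = sets borel" using f by (simp add: purchase_distribution_def)
  let ?E = "expected_ratio a f (ennreal x)" and ?A = "area (survival f) x" and ?S = "survival f x"
  have d: "0 < den a x" using den_pos a x by simp
  have A: "0 \<le> ?A" using area_nonneg[OF is_survival_survival[OF f]] x by simp
  have S: "0 \<le> ?S" using survival_nonneg[OF is_survival_survival[OF f]] .
  have "ennreal (den a x) * ?E + ennreal (1 - a) * ennreal ?S =
      (\<integral>\<^sup>+ t. ennreal (den a x) * ratio a t (ennreal x) + ennreal (1 - a) * indicator {ennreal x<..} t \<partial>f)"
    using x by (simp add: nn_integral_add nn_integral_cmult expected_ratio_def survival_def emeasure_eq_measure sets)
  also have "\<dots> = ennreal (1 - a) * ennreal ?A + ennreal (1 - a + a * x)"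
    using x nn_integral_min_eq_area[OF f, of x]
    by (simp add: ratio_balance[OF a x] nn_integral_add nn_integral_cmult emeasure_space_1)
  also have "\<dots> = ennreal ((1 - a) * ?A + (1 - a + a * x))"
    using a x A by (simp add: ennreal_mult[symmetric] ennreal_plus[symmetric] del: ennreal_plus)
  finally have eq: "ennreal (den a x) * ?E + ennreal (1 - a) * ennreal ?S =
      ennreal ((1 - a) * ?A + (1 - a + a * x))" .
  \<comment> \<open>The right side is finite and \<open>den a x\<close> positive, so the computation
    can move to the reals.\<close>
  then have "?E \<noteq> \<top>" using d by (auto simp: ennreal_mult_top)
  then obtain e where e: "0 \<le> e" "?E = ennreal e" by (cases ?E) auto
  have eq': "den a x * e + (1 - a) * ?S = (1 - a) * ?A + (1 - a + a * x)"
    using eq a d e S A x by (simp add: ennreal_mult[symmetric] ennreal_plus[symmetric] del: ennreal_plus)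
  have "?E \<le> ennreal r \<longleftrightarrow> den a x * e \<le> den a x * r" using e r d by (simp add: ennreal_le_iff)
  also have "\<dots> \<longleftrightarrow> (1 - a) * (?A + 1 - ?S) \<le> r * den a x - a * x"
  proof -
    have "(1 - a) * (?A + 1 - ?S) = den a x * e - a * x" using eq' by (simp add: algebra_simps)
    then show ?thesis by (simp add: mult.commute)
  qed
  also have "\<dots> \<longleftrightarrow> ?A + 1 - ?S \<le> (r * den a x - a * x) / (1 - a)"
    using a by (simp add: pos_le_divide_eq mult.commute)
  finally show ?thesis by (simp add: barrier_def algebra_simps)
qed

lemma expected_ratio_top:
  assumes a: "0 < a" "a < 1" and f: "purchase_distribution f"
  shows "expected_ratio a f \<top> = ennreal (1 + (1 / a - 1) * measure f {\<top>})"
proof -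
  interpret prob_space f using f by (simp add: purchase_distribution_def)
  have sets [measurable_cong]: "sets f = sets borel" using f by (simp add: purchase_distribution_def)
  have a': "0 \<le> 1 / a - 1" using a by simp
  have "ratio a t \<top> = 1 + ennreal (1 / a - 1) * indicator {\<top>} t" for t
    using a ennreal_plus[of 1 "1 / a - 1"] divide_ennreal[of 1 a] by (simp add: ratio_def)
  then have "expected_ratio a f \<top> = 1 + ennreal (1 / a - 1) * measure f {\<top>}"
    by (simp add: expected_ratio_def nn_integral_add nn_integral_cmult emeasure_eq_measure prob_space sets)
  also have "\<dots> = ennreal (1 + (1 / a - 1) * measure f {\<top>})"
    using a' by (simp add: ennreal_mult ennreal_plus)
  finally show ?thesis .
qed

text \<open>Finite stopping times are handled one by one. At \<top> only the mass \<open>p\<close>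
  of never buying matters: \<open>area\<close> is at least \<open>p * x\<close>, so staying within
  reach of a barrier of slope \<open>\<kappa>\<close> forces \<open>p \<le> \<kappa>\<close>, which
  is the bound at \<top>.\<close>

lemma worst_ratio_le_iff:
  assumes a: "0 < a" "a < 1" and r: "1 \<le> r" and f: "purchase_distribution f"
  shows "worst_ratio a f \<le> ennreal r \<longleftrightarrow> ratio_ok a r (survival f)"
proof -
  interpret prob_space f using f by (simp add: purchase_distribution_def)
  have sets: "sets f = sets borel" using f by (simp add: purchase_distribution_def)
  note S = is_survival_survival[OF f]
  have iff: "expected_ratio a f (ennreal x) \<le> ennreal r \<longleftrightarrow>
      area (survival f) x - barrier a r x \<le> survival f x" if "0 < x" for x
    using expected_ratio_le_iff[OF a _ that f] r by simp
  have top: "expected_ratio a f \<top> \<le> ennreal r" if ok: "ratio_ok a r (survival f)"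
  proof -
    define p where "p = measure f {\<top>}"
    define \<kappa> where "\<kappa> = (r - 1) * a / (1 - a)"
    have p: "p \<le> survival f x" for x
      by (auto simp: p_def survival_def sets intro!: finite_measure_mono)
    have lin: "(p - \<kappa>) * x \<le> r" if "1 \<le> x" for x
    proof -
      have "p * (x - 0) \<le> area (survival f) x - area (survival f) 0"
        using that by (intro area_diff_ge[OF S] p) auto
      also have "area (survival f) x \<le> barrier a r x + survival f x"
        using ok that by (simp add: ratio_ok_def algebra_simps)
      also have "\<dots> \<le> barrier a r x + 1" using survival_le_1[OF S] by simp
      also have "barrier a r x = r - 1 + \<kappa> * x" using barrier_ge_1 a that by (simp add: \<kappa>_def)
      finally show ?thesis by (simp add: algebra_simps)
    qed
    have "p \<le> \<kappa>"
    proof (rule ccontr)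
      assume "\<not> p \<le> \<kappa>"
      moreover obtain n where "r / (p - \<kappa>) < real n" using reals_Archimedean2 by blast
      ultimately have "r < real n * (p - \<kappa>)" by (simp add: pos_divide_less_eq)
      \<comment> \<open>The linear bound is available only from time 1 on, hence the
        maximum.\<close>
      also have "\<dots> \<le> max 1 (real n) * (p - \<kappa>)"
        using \<open>\<not> p \<le> \<kappa>\<close> by (intro mult_right_mono) auto
      finally show False using lin[of "max 1 (real n)"] by (simp add: mult.commute)
    qed
    then have "(1 / a - 1) * p \<le> (1 / a - 1) * \<kappa>" using a by (intro mult_left_mono) auto
    also have "\<dots> = r - 1" using a by (simp add: \<kappa>_def field_simps)
    finally show ?thesis using expected_ratio_top[OF a f] by (auto simp: p_def intro!: ennreal_leI)
  qed
  show ?thesis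
  proof
    assume "worst_ratio a f \<le> ennreal r"
    then show "ratio_ok a r (survival f)"
      using iff by (auto simp: worst_ratio_def ratio_ok_def SUP_le_iff)
  next
    assume ok: "ratio_ok a r (survival f)"
    show "worst_ratio a f \<le> ennreal r" unfolding worst_ratio_def
    proof (rule SUP_least)
      fix x :: ennreal assume "x \<in> {0<..}"
      then show "expected_ratio a f x \<le> ennreal r"
        using top[OF ok] iff ok by (cases x) (auto simp: ratio_ok_def)
    qed
  qed
qed

section \<open>Bad intervals and the tail constraint\<close>

lemma L\<^sub>b_ge_1:
  assumes "0 < a" "a < 1" "2 - a \<le> \<gamma>" "a * \<gamma> < 1"
  shows "1 \<le> L\<^sub>b a \<gamma>"
proof -
  \<comment> \<open>The sum equals \<open>\<gamma> + a * \<gamma> - 2\<close>; its last term is the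
    excess of \<open>(2 - a) * (1 + a)\<close> over 2.\<close>
  have "0 \<le> (\<gamma> - (2 - a)) * (1 + a) + a * (1 - a)" using assms by simp
  then have "1 - a * \<gamma> \<le> \<gamma> - 1" by (simp add: algebra_simps)
  then show ?thesis using assms by (simp add: L\<^sub>b_def)
qed

lemma barrier_slope_less_1:
  fixes a \<gamma> :: real
  assumes "0 < a" "a < 1" "a * \<gamma> < 1"
  shows "(\<gamma> - 1) * a / (1 - a) < 1"
proof -
  have "(\<gamma> - 1) * a < 1 * (1 - a)" using assms by (simp add: algebra_simps)
  then show ?thesis using assms pos_divide_less_eq[of "1 - a"] by simp
qed

text \<open>The time \<open>1 + L\<^sub>b a \<gamma>\<close> solves
  \<open>x = \<gamma> * (1 - a + a * x)\<close>: renting throughout reaches ratio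
  \<open>\<gamma>\<close> there. Later bad intervals extend to \<top>, and their left ends start out
  from \<open>L\<^sub>b a \<gamma>\<close>.\<close>

lemma barrier_L\<^sub>b:
  assumes a: "0 < a" "a < 1" and \<gamma>: "2 - a \<le> \<gamma>" "a * \<gamma> < 1"
  shows "barrier a \<gamma> (1 + L\<^sub>b a \<gamma>) = L\<^sub>b a \<gamma>"
proof -
  have "(\<gamma> - 1) + (\<gamma> - 1) * a / (1 - a) * (1 + (\<gamma> - 1) / (1 - a * \<gamma>)) = (\<gamma> - 1) / (1 - a * \<gamma>)"
  proof -
    have 1: "1 + (\<gamma> - 1) / (1 - a * \<gamma>) = \<gamma> * (1 - a) / (1 - a * \<gamma>)"
      using \<gamma> by (simp add: field_simps)
    have "(\<gamma> - 1) * a / (1 - a) * (\<gamma> * (1 - a) / (1 - a * \<gamma>)) = (\<gamma> - 1) * (a * \<gamma>) / (1 - a * \<gamma>)"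
      using a by simp
    then show ?thesis unfolding 1 using \<gamma> by (simp add: field_simps)
  qed
  then show ?thesis using barrier_ge_1[of a "1 + L\<^sub>b a \<gamma>" \<gamma>] L\<^sub>b_ge_1[OF a \<gamma>] a by (simp add: L\<^sub>b_def)
qed

text \<open>Beyond \<open>1 + L\<^sub>b a \<gamma>\<close> the barrier rises from
  \<open>L\<^sub>b a \<gamma>\<close> with slope strictly between 0 and 1.\<close>

lemma barrier_gt_L\<^sub>b:
  assumes a: "0 < a" "a < 1" and \<gamma>: "2 - a \<le> \<gamma>" "a * \<gamma> < 1" and x: "1 + L\<^sub>b a \<gamma> < x"
  shows "L\<^sub>b a \<gamma> < barrier a \<gamma> x" "barrier a \<gamma> x < x"
proof -
  have pos: "0 < (\<gamma> - 1) * a / (1 - a)" using a \<gamma> by simp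
  have L: "1 \<le> L\<^sub>b a \<gamma>" by (rule L\<^sub>b_ge_1[OF a \<gamma>])
  have diff: "barrier a \<gamma> x - L\<^sub>b a \<gamma> = (\<gamma> - 1) * a / (1 - a) * (x - (1 + L\<^sub>b a \<gamma>))"
    using barrier_L\<^sub>b[OF a \<gamma>] barrier_diff_ge_1[of a "1 + L\<^sub>b a \<gamma>" x \<gamma>] L x a by simp
  show "L\<^sub>b a \<gamma> < barrier a \<gamma> x" using diff x pos by (smt (verit) mult_pos_pos)
  have "(\<gamma> - 1) * a / (1 - a) * (x - (1 + L\<^sub>b a \<gamma>)) < 1 * (x - (1 + L\<^sub>b a \<gamma>))"
    using barrier_slope_less_1[OF a \<gamma>(2)] x by (intro mult_strict_right_mono) auto
  then show "barrier a \<gamma> x < x" using diff by simp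
qed

text \<open>For \<open>t \<le> x\<close> the ratio increases with \<open>t\<close> and passes
  \<open>\<gamma>\<close> at the barrier; for \<open>t > x\<close> it is constant in
  \<open>t\<close>. The guard on the sign of the barrier is there because \<open>ennreal\<close>
  maps negative numbers to 0, which would exclude \<open>t = 0\<close>.\<close>

lemma bad_interval_eq:
  assumes a: "0 < a" "a < 1" and \<gamma>: "2 - a \<le> \<gamma>" "a * \<gamma> < 1" and x: "0 < x"
  shows "bad_interval a \<gamma> (ennreal x) =
    {t. t \<le> ennreal x \<and> (0 \<le> barrier a \<gamma> x \<longrightarrow> ennreal (barrier a \<gamma> x) < t)} \<union>
    (if x \<le> 1 + L\<^sub>b a \<gamma> then {} else {ennreal x<..})"
proof -
  have d: "0 < den a x" using den_pos a x by simp
  have g: "0 \<le> \<gamma>" "1 < \<gamma>" using a \<gamma> by auto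
  have low: "ratio a t (ennreal x) > ennreal \<gamma> \<longleftrightarrow> (0 \<le> barrier a \<gamma> x \<longrightarrow> ennreal (barrier a \<gamma> x) < t)"
    if t: "t \<le> ennreal x" for t
  proof -
    obtain r where r: "0 \<le> r" "t = ennreal r" using t by (cases t) (auto simp: top_unique)
    then have rx: "r \<le> x" using t x by simp
    have "ratio a t (ennreal x) > ennreal \<gamma> \<longleftrightarrow> \<gamma> < (r + 1 - a + a * (x - r)) / den a x"
      using ratio_bought[OF a x r(1) rx] r g by (simp add: ennreal_less_iff)
    also have "\<dots> \<longleftrightarrow> \<gamma> * den a x - a * x < (1 - a) * (r + 1)"
      using d by (simp add: pos_less_divide_eq algebra_simps)
    also have "\<dots> \<longleftrightarrow> barrier a \<gamma> x < r"
      using a by (simp add: barrier_def diff_less_eq pos_divide_less_eq mult.commute)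
    also have "\<dots> \<longleftrightarrow> (0 \<le> barrier a \<gamma> x \<longrightarrow> ennreal (barrier a \<gamma> x) < t)"
      using r by (auto simp: ennreal_less_iff)
    finally show ?thesis .
  qed
  have high: "ratio a t (ennreal x) > ennreal \<gamma> \<longleftrightarrow> \<not> x \<le> 1 + L\<^sub>b a \<gamma>" if t: "ennreal x < t" for t
  proof -
    have "ratio a t (ennreal x) > ennreal \<gamma> \<longleftrightarrow> \<gamma> < x / den a x"
      using ratio_not_bought[OF a x t] g by (simp add: ennreal_less_iff)
    also have "\<dots> \<longleftrightarrow> \<gamma> * den a x < x" using d by (simp add: pos_less_divide_eq)
    also have "\<dots> \<longleftrightarrow> \<not> x \<le> 1 + L\<^sub>b a \<gamma>"
    proof (cases "x \<le> 1")
      case True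
      then show ?thesis using L\<^sub>b_ge_1[OF a \<gamma>] g x by (simp add: den_def)
    next
      case False
      have "1 + L\<^sub>b a \<gamma> = \<gamma> * (1 - a) / (1 - a * \<gamma>)"
        using \<gamma> by (simp add: L\<^sub>b_def field_simps)
      then show ?thesis using \<gamma> False by (simp add: den_def pos_divide_less_eq not_le algebra_simps)
    qed
    finally show ?thesis .
  qed
  show ?thesis
  proof (rule set_eqI)
    fix t show "t \<in> bad_interval a \<gamma> (ennreal x) \<longleftrightarrow>
      t \<in> {t. t \<le> ennreal x \<and> (0 \<le> barrier a \<gamma> x \<longrightarrow> ennreal (barrier a \<gamma> x) < t)} \<union>
        (if x \<le> 1 + L\<^sub>b a \<gamma> then {} else {ennreal x<..})"
    proof (cases "t \<le> ennreal x")
      case True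
      then show ?thesis unfolding bad_interval_def using low[OF True] by (simp add: not_less[symmetric])
    next
      case False
      then show ?thesis unfolding bad_interval_def using high[of t] by (simp add: not_le)
    qed
  qed
qed

text \<open>The maximum with 0 covers a barrier beyond \<open>x\<close>, where the interval is empty
  and the difference is at most 0.\<close>

lemma measure_bad_interval_early:
  assumes a: "0 < a" "a < 1" and \<gamma>: "2 - a \<le> \<gamma>" "a * \<gamma> < 1" and x: "0 < x" "x \<le> 1 + L\<^sub>b a \<gamma>"
    and f: "purchase_distribution f"
  shows "measure f (bad_interval a \<gamma> (ennreal x)) = max 0 (survival f (barrier a \<gamma> x) - survival f x)"
proof -
  interpret prob_space f using f by (simp add: purchase_distribution_def)
  have sets: "sets f = sets borel" using f by (simp add: purchase_distribution_def)
  have space: "space f = UNIV" using sets_eq_imp_space_eq[OF sets] by simp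
  note S = is_survival_survival[OF f]
  let ?b = "barrier a \<gamma> x"
  have eq: "bad_interval a \<gamma> (ennreal x) = {t. t \<le> ennreal x \<and> (0 \<le> ?b \<longrightarrow> ennreal ?b < t)}"
    using bad_interval_eq[OF a \<gamma> x(1)] x by simp
  consider "?b < 0" | "0 \<le> ?b" "?b \<le> x" | "x < ?b" by linarith
  then show ?thesis
  proof cases
    case 1
    then have "bad_interval a \<gamma> (ennreal x) = space f - {ennreal x<..}" using eq space by auto
    then show ?thesis using 1 x prob_compl[of "{ennreal x<..}"] survival_le_1[OF S, of x]
      by (simp add: survival_def sets)
  next
    case 2
    have "{ennreal x<..} \<subseteq> {ennreal ?b<..}" using ennreal_leI[OF 2(2)] by simp
    moreover have "bad_interval a \<gamma> (ennreal x) = {ennreal ?b<..} - {ennreal x<..}"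
      unfolding eq using 2(1) by auto
    ultimately have "measure f (bad_interval a \<gamma> (ennreal x)) = survival f ?b - survival f x"
      using 2(1) x(1) by (simp add: survival_def sets finite_measure_Diff)
    then show ?thesis using survival_antimono[OF S 2(2)] by simp
  next
    case 3
    then have "ennreal x < ennreal ?b" using x by (simp add: ennreal_less_iff)
    then have "bad_interval a \<gamma> (ennreal x) = {}"
      unfolding eq using 3 x(1) by (auto dest: order.strict_trans2)
    then show ?thesis using survival_antimono[OF S, of x ?b] 3 by simp
  qed
qed

lemma measure_bad_interval_late:
  assumes a: "0 < a" "a < 1" and \<gamma>: "2 - a \<le> \<gamma>" "a * \<gamma> < 1" and x: "1 + L\<^sub>b a \<gamma> < x"
  shows "measure f (bad_interval a \<gamma> (ennreal x)) = survival f (barrier a \<gamma> x)"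
proof -
  note b = barrier_gt_L\<^sub>b[OF a \<gamma> x]
  have L: "1 \<le> L\<^sub>b a \<gamma>" by (rule L\<^sub>b_ge_1[OF a \<gamma>])
  have "ennreal (barrier a \<gamma> x) < ennreal x" using b L by (simp add: ennreal_less_iff)
  then have "bad_interval a \<gamma> (ennreal x) = {ennreal (barrier a \<gamma> x)<..}"
    using bad_interval_eq[OF a \<gamma>, of x] x L b(1) by (auto intro: order.strict_trans)
  then show ?thesis using b L by (simp add: survival_def)
qed

text \<open>Bad intervals up to time \<open>1 + L\<^sub>b a \<gamma>\<close> give the bounds on
  drops. The later ones are half-lines whose left ends sweep out all times after
  \<open>L\<^sub>b a \<gamma>\<close>, and right-continuity passes their bound to
  \<open>L\<^sub>b a \<gamma>\<close> itself.\<close>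

lemma feasible_iff:
  assumes a: "0 < a" "a < 1" and \<gamma>: "2 - a \<le> \<gamma>" "a * \<gamma> < 1" and \<delta>: "0 \<le> \<delta>"
  shows "feasible a \<gamma> \<delta> f \<longleftrightarrow> purchase_distribution f \<and> tail_ok a \<gamma> \<delta> (survival f)"
proof (cases "purchase_distribution f")
  case f: True
  interpret prob_space f using f by (simp add: purchase_distribution_def)
  have sets: "sets f = sets borel" using f by (simp add: purchase_distribution_def)
  note S = is_survival_survival[OF f]
  note early = measure_bad_interval_early[OF a \<gamma> _ _ f]
  note late = measure_bad_interval_late[OF a \<gamma>]
  note b = barrier_gt_L\<^sub>b[OF a \<gamma>]
  have L: "1 \<le> L\<^sub>b a \<gamma>" by (rule L\<^sub>b_ge_1[OF a \<gamma>])
  have "(\<forall>x>0. measure f (bad_interval a \<gamma> x) \<le> \<delta>) \<longleftrightarrow> tail_ok a \<gamma> \<delta> (survival f)"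
  proof
    assume bad: "\<forall>x>0. measure f (bad_interval a \<gamma> x) \<le> \<delta>"
    have bad': "measure f (bad_interval a \<gamma> (ennreal x)) \<le> \<delta>" if "0 < x" for x
      using bad that by simp
    show "tail_ok a \<gamma> \<delta> (survival f)" unfolding tail_ok_def
    proof (intro conjI allI impI)
      fix x :: real assume x: "0 < x"
      show "survival f (barrier a \<gamma> x) - survival f x \<le> \<delta>"
      proof (cases "x \<le> 1 + L\<^sub>b a \<gamma>")
        case True
        then show ?thesis using early[OF x] bad'[OF x] by simp
      next
        case False
        then show ?thesis using late[of x f] bad'[OF x] survival_nonneg[OF S, of x] by simp
      qed
    next
      have "survival f y \<le> \<delta>" if y: "L\<^sub>b a \<gamma> < y" for y
      proof -
        define s where "s = (\<gamma> - 1) * a / (1 - a)"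
        \<comment> \<open>This choice makes \<open>barrier a \<gamma> x = y\<close>.\<close>
        define x where "x = 1 + L\<^sub>b a \<gamma> + (y - L\<^sub>b a \<gamma>) / s"
        have s: "0 < s" using a \<gamma> by (simp add: s_def)
        have x: "1 + L\<^sub>b a \<gamma> < x" using y s by (simp add: x_def)
        have "barrier a \<gamma> x = barrier a \<gamma> (1 + L\<^sub>b a \<gamma>) + s * (x - (1 + L\<^sub>b a \<gamma>))"
          using barrier_diff_ge_1[of a "1 + L\<^sub>b a \<gamma>" x \<gamma>] x L a by (simp add: s_def)
        also have "\<dots> = y" using s by (simp add: barrier_L\<^sub>b[OF a \<gamma>] x_def)
        finally show ?thesis using late[OF x, of f] bad'[of x] x L by simp
      qed
      then have "eventually (\<lambda>y. survival f y \<le> \<delta>) (at_right (L\<^sub>b a \<gamma>))"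
        by (auto simp: eventually_at_right_field intro!: exI[of _ "L\<^sub>b a \<gamma> + 1"])
      then show "survival f (L\<^sub>b a \<gamma>) \<le> \<delta>"
        by (intro tendsto_upperbound[OF survival_right_tendsto[OF S]]) auto
    qed
  next
    assume ok: "tail_ok a \<gamma> \<delta> (survival f)"
    show "\<forall>x>0. measure f (bad_interval a \<gamma> x) \<le> \<delta>"
    proof (intro allI impI)
      fix x :: ennreal assume x: "0 < x"
      show "measure f (bad_interval a \<gamma> x) \<le> \<delta>"
      proof (cases x)
        case (real r)
        then have r: "0 < r" using x by simp
        show ?thesis
        proof (cases "r \<le> 1 + L\<^sub>b a \<gamma>")
          case True
          then show ?thesis using early[OF r] ok r \<delta> real by (simp add: tail_ok_def)
        next
          case False
          then have "survival f (barrier a \<gamma> r) \<le> survival f (L\<^sub>b a \<gamma>)"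
            using b[of r] by (intro survival_antimono[OF S]) simp
          then show ?thesis using False late[of r f] ok real by (simp add: tail_ok_def)
        qed
      next
        case top
        \<comment> \<open>When the season never ends, only \<open>t = \<top>\<close> can be bad,
          since finite buying times have ratio 1.\<close>
        have "1 < \<gamma>" using a \<gamma> by simp
        then have "bad_interval a \<gamma> x \<subseteq> {ennreal (L\<^sub>b a \<gamma>)<..}"
          using top ennreal_leI[of 1 \<gamma>]
          by (auto simp: bad_interval_def ratio_def not_le[symmetric] top_unique split: if_splits)
        then have "measure f (bad_interval a \<gamma> x) \<le> measure f {ennreal (L\<^sub>b a \<gamma>)<..}"
          by (intro finite_measure_mono) (simp_all add: sets)
        then show ?thesis using ok L by (simp add: tail_ok_def survival_def)
      qed
    qed
  qed
  then show ?thesis using f by (simp add: feasible_def)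
qed (simp add: feasible_def)

section \<open>Compactness of the admissible survival functions\<close>

text \<open>As a minimum of two lines the offline cost is continuous across time 1, which the
  barrier inherits.\<close>

lemma den_eq_min: "a < 1 \<Longrightarrow> den a x = min x (1 - a + a * x)"
proof -
  assume a: "a < 1"
  have "x \<le> 1 - a + a * x \<longleftrightarrow> (1 - a) * x \<le> (1 - a) * 1" by (simp add: algebra_simps)
  also have "\<dots> \<longleftrightarrow> x \<le> 1" using a by simp
  finally show ?thesis by (auto simp: den_def)
qed

lemma barrier_right_tendsto:
  assumes "a < 1"
  shows "(barrier a r \<longlongrightarrow> barrier a r x) (at_right x)"
proof -
  have "barrier a r = (\<lambda>x. (r * min x (1 - a + a * x) - a * x) / (1 - a) - 1)"
    using assms by (simp add: barrier_def den_eq_min fun_eq_iff)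
  moreover have "((\<lambda>x. (r * min x (1 - a + a * x) - a * x) / (1 - a) - 1) \<longlongrightarrow>
      (r * min x (1 - a + a * x) - a * x) / (1 - a) - 1) (at_right x)"
    using assms by (intro tendsto_intros tendsto_min) auto
  ultimately show ?thesis by simp
qed

lemma barrier_strict_mono:
  assumes "0 < a" "a < 1" "1 < r" "x < y"
  shows "barrier a r x < barrier a r y"
proof -
  have "0 < (r - 1) * a / (1 - a) * (y - x)" using assms by simp
  then show ?thesis using barrier_mono[of a r x y] assms by linarith
qed

lemma barrier_perturb: "barrier a (r - e) x = barrier a r x - e * den a x / (1 - a)"
  by (simp add: barrier_def diff_divide_distrib left_diff_distrib)

text \<open>Limits of survival functions are controlled only at continuity points; this supplies
  such points close by on the right, where strict inequalities persist.\<close>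

lemma eventually_at_right_avoid_countable:
  fixes x :: real
  assumes "countable B" "eventually P (at_right x)"
  obtains y where "x < y" "y \<notin> B" "P y"
proof -
  obtain b where b: "x < b" "\<And>y. x < y \<Longrightarrow> y < b \<Longrightarrow> P y"
    using assms(2) by (auto simp: eventually_at_right_field)
  have "\<exists>y\<in>{x<..<b}. y \<notin> B"
    using b assms(1) by (intro open_minus_countable) auto
  then show ?thesis using b that by auto
qed

text \<open>Helly's theorem concerns increasing functions, hence the change of sign. Mass drifting
  to infinity along the sequence becomes probability of never buying.\<close>

lemma survival_Helly:
  fixes G :: "nat \<Rightarrow> real \<Rightarrow> real"
  assumes G: "\<And>n. is_survival (G n)"
  obtains s K where "strict_mono s" "is_survival K"
    "\<And>x. isCont K x \<Longrightarrow> (\<lambda>n. G (s n) x) \<longlonglongrightarrow> K x"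
proof -
  obtain s F where s: "strict_mono s" and F: "\<And>x. continuous (at_right x) F" "mono F"
      "\<And>x. continuous (at x) F \<Longrightarrow> (\<lambda>n. - G (s n) x) \<longlonglongrightarrow> F x"
  proof -
    have "\<exists>s. strict_mono (s :: nat \<Rightarrow> nat) \<and> (\<exists>F. (\<forall>x. continuous (at_right x) F) \<and> mono F \<and>
      (\<forall>x. \<bar>F x\<bar> \<le> 1) \<and> (\<forall>x. continuous (at x) F \<longrightarrow> (\<lambda>n. - G (s n) x) \<longlonglongrightarrow> F x))"
    proof (rule Helly_selection)
      show "continuous (at_right x) (\<lambda>x. - G n x)" for n x
        using G by (intro continuous_intros) (simp add: is_survival_def)
      show "mono (\<lambda>x. - G n x)" for n
        using survival_antimono[OF G] by (simp add: mono_def)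
      show "\<bar>- G n x\<bar> \<le> 1" for n x
        using survival_nonneg[OF G, of n x] survival_le_1[OF G, of n x] by simp
    qed
    then show ?thesis using that by blast
  qed
  define K where "K x = - F x" for x
  have lim: "(\<lambda>n. G (s n) x) \<longlonglongrightarrow> K x" if "isCont K x" for x
  proof -
    have "isCont F x" using continuous_minus[OF that] by (simp add: K_def)
    from tendsto_minus[OF F(3)[OF this]] show ?thesis by (simp add: K_def)
  qed
  have anti: "K y \<le> K x" if "x \<le> y" for x y
    using F(2) that by (simp add: K_def mono_def)
  have rcont: "continuous (at_right x) K" for x
    unfolding K_def by (intro continuous_minus F(1))
  have disc: "countable {x. \<not> isCont K x}"
  proof -
    have "isCont F x \<longleftrightarrow> isCont K x" for x
      unfolding K_def using continuous_minus[of "at x" F] continuous_minus[of "at x" "\<lambda>s. - F s"] by auto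
    then show ?thesis using mono_ctble_discont[OF F(2)] by simp
  qed
  have near: "\<exists>y. x < y \<and> y < b \<and> isCont K y" if "x < b" for x b
  proof -
    have "\<forall>\<^sub>F y in at_right x. y < b" using that by (auto simp: eventually_at_right_field)
    with disc show ?thesis by (rule eventually_at_right_avoid_countable) auto
  qed
  have nonneg: "0 \<le> K x" for x
  proof -
    obtain y where y: "x < y" "isCont K y" using near[of x "x + 1"] by auto
    have "0 \<le> K y"
      by (rule tendsto_lowerbound[OF lim[OF y(2)]]) (simp_all add: survival_nonneg[OF G])
    then show ?thesis using anti[of x y] y by simp
  qed
  \<comment> \<open>At continuity points on both sides of \<open>x\<close> the limit is 1, and
    monotonicity squeezes the value in between.\<close>
  have one: "K x = 1" if neg: "x < 0" for x
  proof -
    have K1: "K y = 1" if "y < 0" "isCont K y" for y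
      using lim[OF that(2)] that(1) by (simp add: survival_neg[OF G] LIMSEQ_const_iff)
    obtain y z where "x - 1 < y" "y < x" "isCont K y" "x < z" "z < 0" "isCont K z"
      using near[of "x - 1" x] near[OF neg] by auto
    then show ?thesis using K1[of y] K1[of z] anti[of y x] anti[of x z] neg by simp
  qed
  have "is_survival K"
    unfolding is_survival_def antimono_def using anti rcont nonneg one by auto
  with s lim show ?thesis using that by blast
qed

text \<open>The constraints pass to the limit at continuity points of \<open>K\<close>, and from
  there to every time by right-continuity.\<close>

lemma admissible_limit:
  fixes G :: "nat \<Rightarrow> real \<Rightarrow> real"
  assumes a: "0 < a" "a < 1" and \<gamma>: "1 < \<gamma>"
    and G: "\<And>n. admissible a \<gamma> \<delta> (r n) (G n)" and r: "r \<longlonglongrightarrow> \<rho>"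
  obtains K where "admissible a \<gamma> \<delta> \<rho> K"
proof -
  have S: "is_survival (G n)" for n using G by (simp add: admissible_def)
  obtain s K where s: "strict_mono s" and K: "is_survival K"
    and lim: "\<And>x. isCont K x \<Longrightarrow> (\<lambda>n. G (s n) x) \<longlonglongrightarrow> K x"
    using survival_Helly[of G, OF S] by blast
  have area_lim: "(\<lambda>n. area (G (s n)) x) \<longlonglongrightarrow> area K x" for x
    by (rule area_tendsto[OF S K lim])
  have r_lim: "(\<lambda>n. r (s n)) \<longlonglongrightarrow> \<rho>"
    using LIMSEQ_subseq_LIMSEQ[OF r s] by (simp add: o_def)
  have barrier_lim: "(\<lambda>n. barrier a (r (s n)) x) \<longlonglongrightarrow> barrier a \<rho> x" for x
    unfolding barrier_def using a by (intro tendsto_intros r_lim) simp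
  have disc: "countable {x. \<not> isCont K x}" by (rule survival_countable_discont[OF K])
  have ratio_cont: "area K y - barrier a \<rho> y \<le> K y" if "0 < y" "isCont K y" for y
    by (rule tendsto_le[OF sequentially_bot lim[OF that(2)] tendsto_diff[OF area_lim barrier_lim]])
      (use G that in \<open>simp add: admissible_def ratio_ok_def\<close>)
  have "ratio_ok a \<rho> K" unfolding ratio_ok_def
  proof (intro allI impI)
    fix x :: real assume x: "0 < x"
    show "area K x - barrier a \<rho> x \<le> K x"
    proof (rule ccontr)
      assume "\<not> ?thesis"
      \<comment> \<open>A violation at \<open>x\<close> survives at a continuity point slightly to
        the right: the barrier is right-continuous, \<open>area K\<close> does not decrease and
        \<open>K\<close> does not increase.\<close>
      then have "barrier a \<rho> x < area K x - K x" by simp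
      moreover have "(barrier a \<rho> \<longlongrightarrow> barrier a \<rho> x) (at_right x)"
        by (rule barrier_right_tendsto[OF a(2)])
      ultimately have "\<forall>\<^sub>F y in at_right x. barrier a \<rho> y < area K x - K x"
        by (rule order_tendstoD(2)[rotated])
      then obtain y where y: "x < y" "isCont K y" "barrier a \<rho> y < area K x - K x"
        by (rule eventually_at_right_avoid_countable[OF disc]) auto
      have "0 * (y - x) \<le> area K y - area K x"
        using x y survival_nonneg[OF K] by (intro area_diff_ge[OF K]) auto
      then show False using ratio_cont[of y] x y survival_antimono[OF K, of x y] by simp
    qed
  qed
  moreover have "tail_ok a \<gamma> \<delta> K" unfolding tail_ok_def
  proof (intro conjI allI impI)
    fix x :: real assume x: "0 < x"
    have mono: "barrier a \<gamma> y < barrier a \<gamma> z" if "y < z" for y z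
      using barrier_strict_mono[OF a \<gamma> that] .
    \<comment> \<open>Both \<open>y\<close> and its barrier value must be continuity points. As the
      barrier is injective, the exceptional times are still countable.\<close>
    let ?N = "{y. \<not> isCont K y} \<union> {y. \<not> isCont K (barrier a \<gamma> y)}"
    have "inj (barrier a \<gamma>)" using mono by (intro strict_mono_imp_inj_on) (simp add: strict_mono_def)
    then have "inj_on (barrier a \<gamma>) A" for A by (rule inj_on_subset) simp
    moreover have "countable (barrier a \<gamma> ` {y. \<not> isCont K (barrier a \<gamma> y)})"
      by (rule countable_subset[OF _ disc]) auto
    ultimately have N: "countable ?N" using disc countable_image_inj_on by blast
    show "K (barrier a \<gamma> x) - K x \<le> \<delta>"
    proof (rule ccontr)
      assume "\<not> ?thesis"
      then have less: "\<delta> + K x < K (barrier a \<gamma> x)" by simp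
      \<comment> \<open>The barrier increases strictly, so its values approach from the right, where
        \<open>K\<close> is continuous.\<close>
      have "filterlim (barrier a \<gamma>) (at_right (barrier a \<gamma> x)) (at_right x)"
        unfolding filterlim_at
      proof
        show "\<forall>\<^sub>F y in at_right x. barrier a \<gamma> y \<in> {barrier a \<gamma> x<..} \<and> barrier a \<gamma> y \<noteq> barrier a \<gamma> x"
          using mono by (auto simp: eventually_at_right_field intro!: exI[of _ "x + 1"] dest: mono)
        show "(barrier a \<gamma> \<longlongrightarrow> barrier a \<gamma> x) (at_right x)"
          by (rule barrier_right_tendsto[OF a(2)])
      qed
      then have "((\<lambda>y. K (barrier a \<gamma> y)) \<longlongrightarrow> K (barrier a \<gamma> x)) (at_right x)"
        by (rule filterlim_compose[OF survival_right_tendsto[OF K]])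
      then have "\<forall>\<^sub>F y in at_right x. \<delta> + K x < K (barrier a \<gamma> y)"
        using less by (rule order_tendstoD(1))
      then obtain y where y: "x < y" "isCont K y" "isCont K (barrier a \<gamma> y)" "\<delta> + K x < K (barrier a \<gamma> y)"
        by (rule eventually_at_right_avoid_countable[OF N]) auto
      have "K (barrier a \<gamma> y) - K y \<le> \<delta>"
        by (rule tendsto_upperbound[OF tendsto_diff[OF lim[OF y(3)] lim[OF y(2)]]])
          (use G x y in \<open>simp_all add: admissible_def tail_ok_def\<close>)
      then show False using y survival_antimono[OF K, of x y] by simp
    qed
  next
    let ?L = "L\<^sub>b a \<gamma>"
    show "K ?L \<le> \<delta>"
    proof (rule ccontr)
      assume "\<not> ?thesis"
      then have "\<forall>\<^sub>F y in at_right ?L. \<delta> < K y"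
        by (intro order_tendstoD(1)[OF survival_right_tendsto[OF K]]) simp
      then obtain y where y: "?L < y" "isCont K y" "\<delta> < K y"
        by (rule eventually_at_right_avoid_countable[OF disc]) auto
      have "G n y \<le> \<delta>" for n
        using survival_antimono[OF S, of ?L y n] y G[of n] by (simp add: admissible_def tail_ok_def)
      then have "K y \<le> \<delta>" by (intro tendsto_upperbound[OF lim[OF y(2)]]) simp_all
      then show False using y by simp
    qed
  qed
  ultimately show ?thesis using that K by (simp add: admissible_def)
qed

section \<open>Explicit admissible survival functions\<close>

text \<open>Buying at time 1 with certainty supplies the upper bound \<open>2 - a\<close> for
  \<open>OPT\<close>; in particular \<open>OPT\<close> is finite.\<close>

lemma admissible_purchase_at_1:
  assumes a: "0 < a" "a < 1" and \<gamma>: "2 - a \<le> \<gamma>" "a * \<gamma> < 1" and \<delta>: "0 \<le> \<delta>"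
  shows "admissible a \<gamma> \<delta> (2 - a) (\<lambda>s. if s < 1 then 1 else 0)"
proof -
  let ?G = "\<lambda>s :: real. if s < 1 then 1 else 0 :: real"
  have S: "is_survival ?G" using survival_cut[OF survival_const_1, of 1] by simp
  have "ratio_ok a (2 - a) ?G" unfolding ratio_ok_def
  proof (intro allI impI)
    fix x :: real assume x: "0 < x"
    show "area ?G x - barrier a (2 - a) x \<le> ?G x"
    proof (cases "x < 1")
      case True
      have "(2 - a - a) / (1 - a) = 2" using a by (simp add: field_simps)
      then show ?thesis using True x area_le[OF S, of x] by (simp add: barrier_le_1)
    next
      case False
      have "area ?G x - area ?G 1 \<le> 0 * (x - 1)" using False by (intro area_diff_le[OF S]) auto
      moreover have "barrier a (2 - a) x = 1 - a + a * x" using a False by (simp add: barrier_ge_1)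
      moreover have "a * 1 \<le> a * x" using a False by (intro mult_left_mono) auto
      ultimately show ?thesis using False area_le[OF S, of 1] by simp
    qed
  qed
  moreover have "tail_ok a \<gamma> \<delta> ?G" unfolding tail_ok_def
  proof (intro conjI allI impI)
    fix x :: real assume "0 < x"
    \<comment> \<open>From time 1 on both values then vanish; before time 1 the subtracted value is
      1.\<close>
    have "1 \<le> barrier a \<gamma> x" if "1 \<le> x"
    proof -
      have "(1 - a) * a / (1 - a) * x \<le> (\<gamma> - 1) * a / (1 - a) * x"
        using a \<gamma> that by (intro mult_right_mono divide_right_mono) auto
      moreover have "a * 1 \<le> a * x" using a that by (intro mult_left_mono) auto
      moreover have "(1 - a) * a / (1 - a) * x = a * x" using a by simp
      ultimately show ?thesis unfolding barrier_ge_1[OF a(2) that] using \<gamma>(1) by linarith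
    qed
    then show "?G (barrier a \<gamma> x) - ?G x \<le> \<delta>" using \<delta> by auto
  next
    show "?G (L\<^sub>b a \<gamma>) \<le> \<delta>" using L\<^sub>b_ge_1[OF a \<gamma>] \<delta> by simp
  qed
  ultimately show ?thesis using S by (simp add: admissible_def)
qed

text \<open>The second tail clause makes \<open>L\<^sub>b a \<gamma>\<close> a time where
  \<open>G\<close> has fallen to \<open>\<delta>\<close>, as \<open>ratio_ok_max\<close> requires;
  truncation at \<open>\<delta>\<close> itself preserves that clause.\<close>

lemma admissible_keep_forever:
  assumes a: "0 < a" "a < 1" and \<gamma>: "2 - a \<le> \<gamma>" "a * \<gamma> < 1" and \<delta>: "0 \<le> \<delta>" "\<delta> \<le> 1"
    and \<rho>: "1 \<le> \<rho>" "\<delta> \<le> (\<rho> - 1) * a / (1 - a)" and G: "admissible a \<gamma> \<delta> \<rho> G"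
  shows "admissible a \<gamma> \<delta> \<rho> (\<lambda>s. max (G s) \<delta>)"
  using G L\<^sub>b_ge_1[OF a \<gamma>] \<delta> survival_max[of G \<delta>] tail_ok_max[of a \<gamma> \<delta> G \<delta>]
    ratio_ok_max[OF a \<rho>(1), of G "L\<^sub>b a \<gamma>" \<delta>] \<rho>(2)
  by (auto simp: admissible_def tail_ok_def)

text \<open>After \<open>L\<^sub>b a \<gamma>\<close> the integral grows at rate at most
  \<open>\<delta>\<close>, the barrier at the larger rate \<open>(\<rho> - 1) * a / (1 - a)\<close>.
  Once the gap gained reaches 1, the constraint holds even with survival 0, so all remaining mass
  may buy.\<close>

lemma admissible_buy_late:
  assumes a: "0 < a" "a < 1" and \<gamma>: "2 - a \<le> \<gamma>" "a * \<gamma> < 1" and \<delta>: "0 \<le> \<delta>"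
    and \<rho>: "1 \<le> \<rho>" "\<delta> < (\<rho> - 1) * a / (1 - a)" and K: "admissible a \<gamma> \<delta> \<rho> K"
  obtains T where "L\<^sub>b a \<gamma> < T" "admissible a \<gamma> \<delta> \<rho> (\<lambda>s. if s < T then K s else 0)"
proof -
  define L where "L = L\<^sub>b a \<gamma>"
  define \<kappa> where "\<kappa> = (\<rho> - 1) * a / (1 - a)"
  \<comment> \<open>The summand \<open>1 / (\<kappa> - \<delta>)\<close> yields a gap of 1; the 2
    puts \<open>T\<close> past \<open>1 + L\<close>, where the barrier for \<open>\<gamma>\<close>
    lies above \<open>L\<close>.\<close>
  define T where "T = L + 2 + 1 / (\<kappa> - \<delta>)"
  have \<kappa>: "\<delta> < \<kappa>" using \<rho> by (simp add: \<kappa>_def)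
  have L: "1 \<le> L" unfolding L_def by (rule L\<^sub>b_ge_1[OF a \<gamma>])
  have T: "1 + L < T" using \<kappa> by (simp add: T_def add_pos_pos)
  let ?G = "\<lambda>s. if s < T then K s else 0"
  have S: "is_survival K" and rK: "ratio_ok a \<rho> K" and tK: "tail_ok a \<gamma> \<delta> K"
    using K by (auto simp: admissible_def)
  have SG: "is_survival ?G" using T L by (intro survival_cut[OF S]) simp
  have K\<delta>: "K s \<le> \<delta>" if "L \<le> s" for s
    using survival_antimono[OF S that] tK by (simp add: tail_ok_def L_def)
  have "ratio_ok a \<rho> ?G" unfolding ratio_ok_def
  proof (intro allI impI)
    fix x :: real assume x: "0 < x"
    have eq: "area ?G z = area K z" if "z \<le> T" for z
      using that by (intro area_cong) auto
    show "area ?G x - barrier a \<rho> x \<le> ?G x"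
    proof (cases "x < T")
      case True
      then show ?thesis using eq[of x] rK x by (simp add: ratio_ok_def)
    next
      case False
      have "area K T - area K L \<le> \<delta> * (T - L)"
        using L T K\<delta> by (intro area_diff_le[OF S]) auto
      moreover have "area K L - barrier a \<rho> L \<le> K L" using rK L by (simp add: ratio_ok_def)
      moreover have "barrier a \<rho> T - barrier a \<rho> L = \<kappa> * (T - L)"
        using L T a by (simp add: barrier_diff_ge_1 \<kappa>_def)
      moreover have "(\<kappa> - \<delta>) * (T - L) = 2 * (\<kappa> - \<delta>) + 1"
        using \<kappa> by (simp add: T_def field_simps)
      then have "\<delta> * (T - L) + 1 \<le> \<kappa> * (T - L)"
        using \<kappa> by (simp add: left_diff_distrib)
      moreover have "area ?G x - area ?G T \<le> 0 * (x - T)"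
        using False L T by (intro area_diff_le[OF SG]) auto
      moreover have "0 \<le> \<kappa> * (x - T)" using \<kappa> \<delta> False by simp
      then have "barrier a \<rho> T \<le> barrier a \<rho> x"
        using barrier_diff_ge_1[of a T x \<rho>] a False L T by (simp add: \<kappa>_def)
      ultimately show ?thesis using survival_le_1[OF S, of L] False eq[of T] by simp
    qed
  qed
  moreover have "tail_ok a \<gamma> \<delta> ?G" unfolding tail_ok_def
  proof (intro conjI allI impI)
    fix x :: real assume x: "0 < x"
    show "?G (barrier a \<gamma> x) - ?G x \<le> \<delta>"
    proof (cases "x < T")
      case True
      then show ?thesis using tK x \<delta> survival_nonneg[OF S, of x] by (simp add: tail_ok_def)
    next
      case False
      then have "L \<le> barrier a \<gamma> x"
        using barrier_gt_L\<^sub>b[OF a \<gamma>, of x] T by (simp add: L_def)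
      then show ?thesis using K\<delta> False \<delta> by simp
    qed
  next
    show "?G (L\<^sub>b a \<gamma>) \<le> \<delta>" using K\<delta>[of L] \<delta> by (simp add: L_def)
  qed
  ultimately have "admissible a \<gamma> \<delta> \<rho> ?G" using SG by (simp add: admissible_def)
  moreover have "L\<^sub>b a \<gamma> < T" using T by (simp add: L_def)
  ultimately show ?thesis by (rule that[rotated])
qed

section \<open>Improving a survival function with spare tail mass\<close>

text \<open>From time 1 on, integral minus barrier does not decrease until the plateau begins and is
  constant afterwards, so \<open>Y\<close> is a maximum. It is below \<open>\<kappa>\<close> there:
  for \<open>y \<ge> 1\<close>, equality would by \<open>ratio_ok_tight\<close> contradict
  \<open>G w < \<kappa>\<close>; for \<open>y < 1\<close>, the barrier rises with slope at least 1,
  more than \<open>\<kappa>\<close>, until time 1.\<close>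

lemma plateau_slack:
  assumes a: "0 < a" "a < 1" and \<rho>: "1 \<le> \<rho>" "\<kappa> = (\<rho> - 1) * a / (1 - a)" "\<kappa> < 1"
    and G: "is_survival G" "ratio_ok a \<rho> G" and w: "1 \<le> w" "G w < \<kappa>"
  obtains M where "M < \<kappa>" "\<And>x. 1 \<le> x \<Longrightarrow> area (\<lambda>s. max (G s) \<kappa>) x - barrier a \<rho> x \<le> M"
proof -
  let ?K = "\<lambda>s. max (G s) \<kappa>"
  let ?D = "\<lambda>x. area ?K x - barrier a \<rho> x"
  have K: "is_survival ?K" using \<rho> G by (intro survival_max) auto
  obtain y where y: "0 \<le> y" "y \<le> w" "G y \<le> \<kappa>" "\<And>s. 0 \<le> s \<Longrightarrow> s < y \<Longrightarrow> \<kappa> < G s"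
    by (rule survival_hitting_point[OF G(1), of w \<kappa> 0]) (use w in auto)
  have y0: "0 < y" using y(1,3) ratio_ok_0[OF G] \<rho> by (cases "y = 0") auto
  have after: "G s \<le> \<kappa>" if "y \<le> s" for s
    using survival_antimono[OF G(1) that] y(3) by simp
  have "area ?K y = area G y"
    by (rule area_cong, rule max_absorb1, rule less_imp_le, rule y(4)) auto
  then have Dy: "?D y = area G y - barrier a \<rho> y" by simp
  have Dy_le: "?D y \<le> \<kappa>"
    using G(2)[unfolded ratio_ok_def, rule_format, OF y0] y(3) Dy by simp
  define Y where "Y = max 1 y"
  have "?D Y < \<kappa>"
  proof (cases "1 \<le> y")
    case True
    then have "Y = y" by (simp add: Y_def)
    show ?thesis
    proof (rule ccontr)
      assume "\<not> ?thesis"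
      then have "\<kappa> \<le> area G y - barrier a \<rho> y" using Dy \<open>Y = y\<close> by simp
      from ratio_ok_tight[OF a \<rho>(1,2) G True this, of w] show False using w by simp
    qed
  next
    case False
    have "area ?K 1 - area ?K y \<le> \<kappa> * (1 - y)"
      using False y after by (intro area_diff_le[OF K]) auto
    moreover have "1 - y \<le> barrier a \<rho> 1 - barrier a \<rho> y"
      using False a \<rho> by (intro barrier_mono_small) auto
    moreover have "\<kappa> * (1 - y) < 1 * (1 - y)"
      using False \<rho>(3) by (intro mult_strict_right_mono) auto
    moreover have "Y = 1" using False by (simp add: Y_def)
    ultimately show ?thesis using Dy_le by simp
  qed
  moreover have "?D x \<le> ?D Y" if x: "1 \<le> x" for x
  proof (cases "x \<le> Y")
    case True
    have "\<kappa> * (Y - x) \<le> area ?K Y - area ?K x"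
      using x True by (intro area_diff_ge[OF K]) auto
    moreover have "barrier a \<rho> Y - barrier a \<rho> x = \<kappa> * (Y - x)"
      using x a by (simp add: barrier_diff_ge_1 \<rho>(2) Y_def)
    ultimately show ?thesis by simp
  next
    case False
    have "area ?K x - area ?K Y \<le> \<kappa> * (x - Y)"
      using False after by (intro area_diff_le[OF K]) (auto simp: Y_def)
    moreover have "barrier a \<rho> x - barrier a \<rho> Y = \<kappa> * (x - Y)"
      using x a by (simp add: barrier_diff_ge_1 \<rho>(2) Y_def)
    ultimately show ?thesis by simp
  qed
  ultimately show ?thesis by (rule that)
qed

text \<open>Lowering the plateau to some \<open>\<theta>\<close> between \<open>M\<close> and
  \<open>\<kappa>\<close> does not raise the integral and leaves slack \<open>\<theta> - M\<close>.
  Past \<open>w\<close> the barrier gains a further \<open>\<kappa> - \<theta>\<close> per unit of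
  time, enough for slack proportional to \<open>den a x\<close>.\<close>

lemma truncation_slack:
  assumes a: "0 < a" "a < 1" and \<rho>: "1 \<le> \<rho>" "\<kappa> = (\<rho> - 1) * a / (1 - a)" "\<kappa> < 1"
    and G: "is_survival G" "ratio_ok a \<rho> G" and w: "1 \<le> w" "G w < \<kappa>"
  obtains \<theta> \<eta> where "G w < \<theta>" "\<theta> < \<kappa>" "0 < \<eta>"
    "\<And>x. 1 \<le> x \<Longrightarrow> area (\<lambda>s. max (G s) \<theta>) x - barrier a \<rho> x + \<eta> * den a x \<le> max (G x) \<theta>"
proof -
  obtain M where M: "M < \<kappa>" "\<And>x. 1 \<le> x \<Longrightarrow> area (\<lambda>s. max (G s) \<kappa>) x - barrier a \<rho> x \<le> M"
    by (rule plateau_slack[OF assms]) (rule that)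
  define \<theta> where "\<theta> = (max M (G w) + \<kappa>) / 2"
  have \<theta>: "G w < \<theta>" "M < \<theta>" "\<theta> < \<kappa>" using M w by (auto simp: \<theta>_def)
  let ?H = "\<lambda>s. max (G s) \<theta>"
  have H: "is_survival ?H" using \<theta> \<rho> G by (intro survival_max) auto
  have K: "is_survival (\<lambda>s. max (G s) \<kappa>)" using \<rho> G by (intro survival_max) auto
  have D: "area ?H x - barrier a \<rho> x \<le> M" if "1 \<le> x" for x
  proof -
    have "area ?H x \<le> area (\<lambda>s. max (G s) \<kappa>) x"
      using \<theta> by (intro area_mono[OF H K]) auto
    then show ?thesis using M(2)[OF that] by simp
  qed
  define W where "W = 1 - a + a * w"
  have W: "0 < W" using a w by (simp add: W_def add_pos_pos)
  \<comment> \<open>The first bound serves times up to \<open>w\<close>, where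
    \<open>den a x \<le> W\<close>; the second keeps the later growth rate \<open>\<eta> * a\<close>
    within \<open>\<kappa> - \<theta>\<close>.\<close>
  define \<eta> where "\<eta> = min ((\<theta> - M) / W) (\<kappa> - \<theta>)"
  have \<eta>: "0 < \<eta>" using \<theta> W by (simp add: \<eta>_def)
  have \<eta>W: "\<eta> * W \<le> \<theta> - M" using W by (simp add: \<eta>_def min_def pos_le_divide_eq[symmetric])
  have \<eta>a: "\<eta> * a \<le> \<kappa> - \<theta>"
  proof -
    have "\<eta> * a \<le> \<eta> * 1" using \<eta> a by (intro mult_left_mono) auto
    then show ?thesis by (simp add: \<eta>_def)
  qed
  have "area ?H x - barrier a \<rho> x + \<eta> * den a x \<le> ?H x" if x: "1 \<le> x" for x
  proof (cases "x \<le> w")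
    case True
    have "den a x \<le> W" using True x a by (auto simp: den_def W_def)
    then have "\<eta> * den a x \<le> \<eta> * W" using \<eta> by (intro mult_left_mono) auto
    then show ?thesis using D[OF x] \<eta>W by simp
  next
    case False
    have le: "?H s \<le> \<theta>" if "w \<le> s" for s
      using survival_antimono[OF G(1) that] \<theta> by simp
    have "area ?H x - area ?H w \<le> \<theta> * (x - w)"
      using False w le by (intro area_diff_le[OF H]) auto
    moreover have "barrier a \<rho> x - barrier a \<rho> w = \<kappa> * (x - w)"
      using x w a by (simp add: barrier_diff_ge_1 \<rho>(2))
    moreover have "\<eta> * den a x = \<eta> * W + \<eta> * a * (x - w)"
      using False w by (simp add: den_def W_def algebra_simps)
    moreover have "\<eta> * a * (x - w) \<le> (\<kappa> - \<theta>) * (x - w)"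
      using \<eta>a False by (intro mult_right_mono) auto
    ultimately show ?thesis using D[OF w(1)] \<eta>W by (simp add: left_diff_distrib)
  qed
  with \<theta>(1,3) \<eta> show ?thesis by (rule that)
qed

text \<open>Never buying with a small probability turns the slack beyond time 1 into a strict
  improvement at all times, since never buying is optimal before time 1.\<close>
lemma strictly_better_relaxed:
  assumes a: "0 < a" "a < 1" and \<rho>: "1 < \<rho>" and \<eta>: "0 < \<eta>"
    and H: "is_survival H" "ratio_ok a \<rho> H"
    and slack: "\<And>x. 1 \<le> x \<Longrightarrow> area H x - barrier a \<rho> x + \<eta> * den a x \<le> H x"
  obtains p q e where "0 \<le> p" "0 \<le> q" "p + q = 1" "0 < e" "e \<le> \<rho> - 1"
    "ratio_ok a (\<rho> - e) (\<lambda>s. p * H s + q * 1)"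
proof -
  \<comment> \<open>These choices give \<open>q * \<eta> + q / a = \<eta> / 2\<close>. After time 1,
    per unit of \<open>den a x\<close>, the mixture has slack \<open>(1 - q) * \<eta>\<close> from
    \<open>H\<close> and loses at most \<open>q / a\<close> to never buying; the remaining
    \<open>\<eta> / 2\<close> pays for lowering the ratio by \<open>e\<close>. The bound
    \<open>q * (\<rho> - 1)\<close> on \<open>e\<close> serves times up to 1.\<close>
  define X where "X = \<eta> + 1 / a"
  define q where "q = \<eta> / (2 * X)"
  define e where "e = min (q * (\<rho> - 1)) ((1 - a) * (\<eta> / 2))"
  have X: "0 < X" "\<eta> \<le> X" using a \<eta> by (auto simp: X_def add_pos_pos)
  have q: "0 < q" "q \<le> 1 / 2" using \<eta> X by (auto simp: q_def pos_divide_le_eq)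
  have "q * X = \<eta> / 2" using X by (simp add: q_def)
  then have q\<eta>: "q / a = \<eta> / 2 - q * \<eta>" by (simp add: X_def algebra_simps)
  have e: "0 < e" "e \<le> q * (\<rho> - 1)" "e / (1 - a) \<le> \<eta> / 2"
    using q \<rho> \<eta> a by (auto simp: e_def pos_divide_le_eq mult.commute)
  have "q * (\<rho> - 1) \<le> 1 * (\<rho> - 1)" using q \<rho> by (intro mult_right_mono) auto
  then have e1: "e \<le> \<rho> - 1" using e by simp
  have "ratio_ok a (\<rho> - e) (\<lambda>s. (1 - q) * H s + q * 1)" unfolding ratio_ok_def
  proof (intro allI impI)
    fix x :: real assume x: "0 < x"
    have A: "area (\<lambda>s. (1 - q) * H s + q * 1) x = (1 - q) * area H x + q * x"
      using area_mix[OF H(1) survival_const_1, of "1 - q" q x] x by (simp add: area_const)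
    \<comment> \<open>The brackets are the slacks of \<open>H\<close> and of never buying at ratio
      \<open>\<rho>\<close>; the last term is the price of lowering the ratio.\<close>
    have "0 \<le> (1 - q) * (H x - (area H x - barrier a \<rho> x)) + q * (1 - x + barrier a \<rho> x) - e * den a x / (1 - a)"
    proof (cases "x \<le> 1")
      case True
      have "0 \<le> (1 - q) * (H x - (area H x - barrier a \<rho> x))"
        using H(2) x q by (intro mult_nonneg_nonneg) (auto simp: ratio_ok_def)
      moreover have "1 - x + barrier a \<rho> x = (\<rho> - 1) / (1 - a) * x"
        using True a by (simp add: barrier_le_1 field_simps)
      moreover have "e * x / (1 - a) \<le> q * (\<rho> - 1) * x / (1 - a)"
        using e x a by (intro divide_right_mono mult_right_mono) auto
      ultimately show ?thesis using True by (simp add: den_def)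
    next
      case False
      have d: "0 < den a x" "a * x \<le> den a x" using den_pos[OF a x] False a by (auto simp: den_def)
      have "(1 - q) * (\<eta> * den a x) \<le> (1 - q) * (H x - (area H x - barrier a \<rho> x))"
        using slack[of x] False q by (intro mult_left_mono) auto
      moreover have "q * (- (den a x / a)) \<le> q * (1 - x + barrier a \<rho> x)"
      proof (intro mult_left_mono)
        have "x \<le> den a x / a" using d a by (simp add: pos_le_divide_eq mult.commute)
        moreover have "barrier a \<rho> 0 \<le> barrier a \<rho> x"
          using barrier_strict_mono[OF a \<rho> x] by simp
        ultimately show "- (den a x / a) \<le> 1 - x + barrier a \<rho> x" by (simp add: barrier_0)
      qed (use q in simp)
      moreover have "e * den a x / (1 - a) \<le> \<eta> / 2 * den a x"
        using mult_right_mono[OF e(3), of "den a x"] d by simp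
      moreover have "q * (- (den a x / a)) = q * \<eta> * den a x - \<eta> / 2 * den a x"
      proof -
        have "q * (- (den a x / a)) = - (q / a) * den a x" by simp
        also have "\<dots> = q * \<eta> * den a x - \<eta> / 2 * den a x"
          unfolding q\<eta> by (simp add: algebra_simps)
        finally show ?thesis .
      qed
      moreover have "(1 - q) * (\<eta> * den a x) = \<eta> * den a x - q * \<eta> * den a x"
        by (simp add: algebra_simps)
      moreover have "0 \<le> \<eta> * den a x" using \<eta> d by simp
      ultimately show ?thesis by linarith
    qed
    then show "area (\<lambda>s. (1 - q) * H s + q * 1) x - barrier a (\<rho> - e) x \<le> (1 - q) * H x + q * 1"
      unfolding A barrier_perturb by (simp add: algebra_simps)
  qed
  then show ?thesis using q e e1 by (intro that[of "1 - q" q e]) auto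
qed

text \<open>The constraint is affine jointly in the survival function and the ratio.\<close>

lemma ratio_ok_mix:
  assumes "is_survival G" "is_survival K" "ratio_ok a r G" "ratio_ok a (r - e) K"
    and "0 \<le> p" "0 \<le> q" "p + q = 1"
  shows "ratio_ok a (r - q * e) (\<lambda>s. p * G s + q * K s)"
  unfolding ratio_ok_def
proof (intro allI impI)
  fix x :: real assume x: "0 < x"
  let ?d = "e * den a x / (1 - a)"
  have "p * (area G x - barrier a r x) \<le> p * G x"
    using assms x by (intro mult_left_mono) (auto simp: ratio_ok_def)
  moreover have "q * (area K x - barrier a r x + ?d) \<le> q * K x"
  proof (intro mult_left_mono)
    have "area K x - barrier a (r - e) x \<le> K x" using assms x by (simp add: ratio_ok_def)
    then show "area K x - barrier a r x + ?d \<le> K x" by (simp add: barrier_perturb)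
  qed fact
  moreover have "barrier a (r - q * e) x = barrier a r x - q * ?d"
    by (simp add: barrier_perturb)
  moreover have "p * barrier a r x + q * barrier a r x = barrier a r x"
    using assms(7) by (simp add: distrib_right[symmetric])
  ultimately show "area (\<lambda>s. p * G s + q * K s) x - barrier a (r - q * e) x \<le> p * G x + q * K x"
    by (simp add: area_mix[OF assms(1,2)] distrib_left right_diff_distrib)
qed

text \<open>The relaxed improvement \<open>?P\<close> keeps all drops within \<open>\<delta>\<close>
  and can only break the bound at \<open>L\<close>. As \<open>G\<close> leaves room
  \<open>\<mu>\<close> there and \<open>?P L \<le> 1\<close>, a share \<open>\<mu>\<close> of it can
  be mixed in, lowering the ratio by \<open>\<mu> * e\<close>.\<close>

lemma admissible_improvable:
  assumes a: "0 < a" "a < 1" and \<gamma>: "2 - a \<le> \<gamma>" "a * \<gamma> < 1"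
    and \<rho>: "1 < \<rho>" "\<rho> \<le> 2 - a" "\<delta> < (\<rho> - 1) * a / (1 - a)"
    and G: "admissible a \<gamma> \<delta> \<rho> G" "G (L\<^sub>b a \<gamma>) < \<delta>"
  obtains r K where "1 \<le> r" "r < \<rho>" "admissible a \<gamma> \<delta> r K"
proof -
  define L where "L = L\<^sub>b a \<gamma>"
  define \<kappa> where "\<kappa> = (\<rho> - 1) * a / (1 - a)"
  have L: "1 \<le> L" unfolding L_def by (rule L\<^sub>b_ge_1[OF a \<gamma>])
  have S: "is_survival G" and rG: "ratio_ok a \<rho> G" and tG: "tail_ok a \<gamma> \<delta> G"
    using G by (auto simp: admissible_def)
  have \<delta>: "0 \<le> \<delta>" "G L < \<delta>" using G(2) survival_nonneg[OF S, of L] by (auto simp: L_def)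
  \<comment> \<open>From \<open>\<rho> \<le> 2 - a\<close> the slope \<open>\<kappa>\<close> is at
    most \<open>a\<close>, hence below 1, as truncation at \<open>\<kappa>\<close> demands.\<close>
  have "(\<rho> - 1) * a / (1 - a) \<le> (1 - a) * a / (1 - a)"
    using a \<rho> by (intro divide_right_mono mult_right_mono) auto
  then have "\<kappa> \<le> a" using a by (simp add: \<kappa>_def)
  then have \<kappa>: "\<delta> < \<kappa>" "\<kappa> < 1" using a \<rho>(3) by (simp_all only: \<kappa>_def)
  obtain \<theta> \<eta> where \<theta>: "G L < \<theta>" "\<theta> < \<kappa>" and \<eta>: "0 < \<eta>" and
    slack: "\<And>x. 1 \<le> x \<Longrightarrow> area (\<lambda>s. max (G s) \<theta>) x - barrier a \<rho> x + \<eta> * den a x \<le> max (G x) \<theta>"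
    by (rule truncation_slack[OF a less_imp_le[OF \<rho>(1)] \<kappa>_def \<kappa>(2) S rG L])
      (use \<delta> \<kappa> that in auto)
  let ?H = "\<lambda>s. max (G s) \<theta>"
  have H: "is_survival ?H" using \<theta> \<kappa> by (intro survival_max[OF S]) simp
  have rH: "ratio_ok a \<rho> ?H"
    by (rule ratio_ok_max[OF a less_imp_le[OF \<rho>(1)] S rG, of L])
      (use L \<theta> \<kappa> in \<open>simp_all add: \<kappa>_def[symmetric]\<close>)
  obtain p q e where pq: "0 \<le> p" "0 \<le> q" "p + q = 1" and e: "0 < e" "e \<le> \<rho> - 1"
    and rP: "ratio_ok a (\<rho> - e) (\<lambda>s. p * ?H s + q * 1)"
    by (rule strictly_better_relaxed[OF a \<rho>(1) \<eta> H rH slack]) (use that in auto)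
  let ?P = "\<lambda>s. p * ?H s + q * 1"
  have P: "is_survival ?P" by (rule survival_mix[OF H survival_const_1 pq])
  define \<mu> where "\<mu> = \<delta> - G L"
  have \<mu>: "0 < \<mu>" "\<mu> \<le> 1" using \<delta> \<kappa> survival_nonneg[OF S, of L] by (auto simp: \<mu>_def)
  let ?K = "\<lambda>s. (1 - \<mu>) * G s + \<mu> * ?P s"
  have "is_survival ?K" using \<mu> by (intro survival_mix[OF S P]) auto
  moreover have "ratio_ok a (\<rho> - \<mu> * e) ?K" using \<mu> by (intro ratio_ok_mix[OF S P rG rP]) auto
  moreover have "tail_ok a \<gamma> \<delta> ?K" unfolding tail_ok_def
  proof (intro conjI allI impI)
    fix x :: real assume x: "0 < x"
    let ?b = "barrier a \<gamma> x"
    have drop: "G ?b - G x \<le> \<delta>" using tG x by (simp add: tail_ok_def)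
    \<comment> \<open>\<open>\<theta>\<close> may exceed \<open>\<delta>\<close>, which rules out
      \<open>tail_ok_max\<close>; drops still do not grow.\<close>
    then have "?H ?b - ?H x \<le> \<delta>" using \<delta> by (auto simp: max_def)
    then have "p * (?H ?b - ?H x) \<le> p * \<delta>" using pq by (intro mult_left_mono) auto
    also have "p * \<delta> \<le> 1 * \<delta>" using pq \<delta> by (intro mult_right_mono) auto
    finally have "?P ?b - ?P x \<le> \<delta>" by (simp add: right_diff_distrib)
    then have "\<mu> * (?P ?b - ?P x) \<le> \<mu> * \<delta>" using \<mu> by (intro mult_left_mono) auto
    moreover have "(1 - \<mu>) * (G ?b - G x) \<le> (1 - \<mu>) * \<delta>"
      using \<mu> drop by (intro mult_left_mono) auto
    moreover have "?K ?b - ?K x = (1 - \<mu>) * (G ?b - G x) + \<mu> * (?P ?b - ?P x)"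
      by (simp add: algebra_simps)
    moreover have "(1 - \<mu>) * \<delta> + \<mu> * \<delta> = \<delta>" by (simp add: algebra_simps)
    ultimately show "?K ?b - ?K x \<le> \<delta>" by linarith
  next
    have "\<mu> * ?P L \<le> \<mu> * 1" using \<mu> survival_le_1[OF P, of L] by (intro mult_left_mono) auto
    moreover have "(1 - \<mu>) * G L \<le> 1 * G L"
      using \<mu> survival_nonneg[OF S, of L] by (intro mult_right_mono) auto
    ultimately show "?K (L\<^sub>b a \<gamma>) \<le> \<delta>" by (simp add: \<mu>_def L_def)
  qed
  ultimately have "admissible a \<gamma> \<delta> (\<rho> - \<mu> * e) ?K" by (simp add: admissible_def)
  moreover have "\<rho> - \<mu> * e < \<rho>" using \<mu> e by simp
  moreover have "\<mu> * e \<le> 1 * e" using \<mu> e by (intro mult_right_mono) auto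
  then have "1 \<le> \<rho> - \<mu> * e" using e(2) by linarith
  ultimately show ?thesis using that by blast
qed

section \<open>From admissible survival functions to optimal distributions\<close>

lemma OPT_le:
  assumes a: "0 < a" "a < 1" and \<gamma>: "2 - a \<le> \<gamma>" "a * \<gamma> < 1" and \<delta>: "0 \<le> \<delta>" and r: "1 \<le> r"
    and G: "admissible a \<gamma> \<delta> r G"
  shows "OPT a \<gamma> \<delta> \<le> ennreal r"
proof -
  obtain f where f: "purchase_distribution f" "survival f = G"
    using survival_realised[of G] G by (auto simp: admissible_def)
  then have "feasible a \<gamma> \<delta> f" using feasible_iff[OF a \<gamma> \<delta>] G by (simp add: admissible_def)
  then have "OPT a \<gamma> \<delta> \<le> worst_ratio a f" unfolding OPT_def by (intro INF_lower) simp
  also have "\<dots> \<le> ennreal r" using worst_ratio_le_iff[OF a r f(1)] f G by (simp add: admissible_def)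
  finally show ?thesis .
qed

lemma optimal_iff:
  assumes a: "0 < a" "a < 1" and \<gamma>: "2 - a \<le> \<gamma>" "a * \<gamma> < 1" and \<delta>: "0 \<le> \<delta>"
    and \<rho>: "1 \<le> \<rho>" "OPT a \<gamma> \<delta> = ennreal \<rho>"
  shows "optimal a \<gamma> \<delta> f \<longleftrightarrow> purchase_distribution f \<and> admissible a \<gamma> \<delta> \<rho> (survival f)"
proof -
  have "worst_ratio a f = OPT a \<gamma> \<delta> \<longleftrightarrow> worst_ratio a f \<le> ennreal \<rho>" if "feasible a \<gamma> \<delta> f"
  proof -
    have "OPT a \<gamma> \<delta> \<le> worst_ratio a f" unfolding OPT_def using that by (intro INF_lower) simp
    then show ?thesis using \<rho> by auto
  qed
  then show ?thesis
    using feasible_iff[OF a \<gamma> \<delta>] worst_ratio_le_iff[OF a \<rho>(1)] is_survival_survival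
    by (auto simp: optimal_def admissible_def)
qed

text \<open>The infimum provides survival functions with ratios
  \<open>\<rho> + 1 / real (Suc n)\<close>; a Helly limit of them achieves
  \<open>\<rho>\<close>.\<close>

lemma OPT_attained:
  assumes a: "0 < a" "a < 1" and \<gamma>: "2 - a \<le> \<gamma>" "a * \<gamma> < 1" and \<delta>: "0 \<le> \<delta>"
    and \<rho>: "1 \<le> \<rho>" "OPT a \<gamma> \<delta> = ennreal \<rho>"
  obtains G where "admissible a \<gamma> \<delta> \<rho> G"
proof -
  define r where "r n = \<rho> + 1 / real (Suc n)" for n
  have "\<exists>G. admissible a \<gamma> \<delta> (r n) G" for n
  proof -
    have "OPT a \<gamma> \<delta> < ennreal (r n)" using \<rho> by (simp add: r_def ennreal_less_iff)
    then obtain f where f: "feasible a \<gamma> \<delta> f" "worst_ratio a f < ennreal (r n)"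
      unfolding OPT_def INF_less_iff by auto
    have "1 \<le> r n" using \<rho> by (simp add: r_def add_increasing2)
    then show ?thesis
      using f(1) less_imp_le[OF f(2)] feasible_iff[OF a \<gamma> \<delta>]
        worst_ratio_le_iff[OF a \<open>1 \<le> r n\<close>] is_survival_survival
      by (auto simp: admissible_def intro!: exI[of _ "survival f"])
  qed
  then obtain G where G: "\<And>n. admissible a \<gamma> \<delta> (r n) (G n)" by metis
  have "r \<longlonglongrightarrow> \<rho> + 0" unfolding r_def
    by (intro tendsto_add tendsto_const) (use LIMSEQ_inverse_real_of_nat in \<open>simp add: inverse_eq_divide\<close>)
  then have "r \<longlonglongrightarrow> \<rho>" by simp
  have "1 < \<gamma>" using a \<gamma> by simp
  then show ?thesis by (rule admissible_limit[OF a _ G \<open>r \<longlonglongrightarrow> \<rho>\<close>]) (rule that)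
qed

theorem theorem3:
  fixes a \<gamma> \<delta> :: real
  assumes "0 \<le> a" and "a < 1"
    and "2 - a \<le> \<gamma>" and "ennreal \<gamma> < 1 / ennreal a"
    and "0 \<le> \<delta>" and "\<delta> \<le> 1"
    and "ennreal \<delta> < (OPT a \<gamma> \<delta> - 1) / (1 / ennreal a - 1)"
  shows "(\<exists>f. optimal a \<gamma> \<delta> f) \<and>
         (0 < \<delta> \<longrightarrow> (\<exists>f g. optimal a \<gamma> \<delta> f \<and> optimal a \<gamma> \<delta> g \<and> f \<noteq> g)) \<and>
         1 \<le> L\<^sub>b a \<gamma> \<and>
         (\<forall>f. optimal a \<gamma> \<delta> f \<longrightarrow> measure f {ennreal (L\<^sub>b a \<gamma>)<..} = \<delta>)"
proof -
  \<comment> \<open>For \<open>a = 0\<close> the denominator is \<top>, so the quotient is 0 and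
    \<open>ennreal \<delta>\<close> cannot lie below it.\<close>
  have "a \<noteq> 0" using assms(7) by (auto simp: divide_ennreal_def)
  then have a: "0 < a" "a < 1" using assms by auto
  have inv_a: "1 / ennreal a = ennreal (1 / a)" using divide_ennreal[of 1 a] a by simp
  have "0 \<le> \<gamma>" using assms by simp
  then have "\<gamma> < 1 / a" using assms(4) by (simp add: inv_a ennreal_less_iff)
  then have \<gamma>: "2 - a \<le> \<gamma>" "a * \<gamma> < 1" using assms a by (auto simp: pos_less_divide_eq mult.commute)
  note \<delta> = assms(5,6)
  have OPT_ub: "OPT a \<gamma> \<delta> \<le> ennreal (2 - a)"
    using a by (intro OPT_le[OF a \<gamma> \<delta>(1) _ admissible_purchase_at_1[OF a \<gamma> \<delta>(1)]]) simp
  then obtain \<rho> where \<rho>: "0 \<le> \<rho>" "OPT a \<gamma> \<delta> = ennreal \<rho>"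
    by (cases "OPT a \<gamma> \<delta>") (auto simp: top_unique)
  have \<rho>2: "\<rho> \<le> 2 - a" using OPT_ub \<rho> a by (simp add: ennreal_le_iff)
  \<comment> \<open>Subtraction is truncated: for \<open>\<rho> \<le> 1\<close> the numerator would
    be 0, again leaving no room for \<open>\<delta>\<close>.\<close>
  have \<rho>1: "1 < \<rho>"
  proof (rule ccontr)
    assume "\<not> 1 < \<rho>"
    then have "OPT a \<gamma> \<delta> - 1 = 0"
      using ennreal_minus[of 1 \<rho>] by (simp add: \<rho> ennreal_neg)
    then show False using assms(7) by simp
  qed
  have "(OPT a \<gamma> \<delta> - 1) / (1 / ennreal a - 1) = ennreal ((\<rho> - 1) / (1 / a - 1))"
    using a \<rho>1 ennreal_minus[of 1 \<rho>] ennreal_minus[of 1 "1 / a"] divide_ennreal[of "\<rho> - 1" "1 / a - 1"]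
    by (simp add: inv_a \<rho>)
  then have "\<delta> < (\<rho> - 1) / (1 / a - 1)" using assms(7) \<delta> by (simp add: ennreal_less_iff)
  \<comment> \<open>In this form the hypothesis compares \<open>\<delta>\<close> with the slope of
    the barrier for \<open>\<rho>\<close> beyond time 1.\<close>
  also have "(\<rho> - 1) / (1 / a - 1) = (\<rho> - 1) * a / (1 - a)" using a by (simp add: field_simps)
  finally have \<kappa>: "\<delta> < (\<rho> - 1) * a / (1 - a)" .
  note opt = optimal_iff[OF a \<gamma> \<delta>(1) less_imp_le[OF \<rho>1] \<rho>(2)]
  have realise: "\<exists>f. optimal a \<gamma> \<delta> f \<and> survival f = G" if "admissible a \<gamma> \<delta> \<rho> G" for G
    using survival_realised[of G] opt that unfolding admissible_def by metis
  obtain G where G: "admissible a \<gamma> \<delta> \<rho> G"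
    by (rule OPT_attained[OF a \<gamma> \<delta>(1) less_imp_le[OF \<rho>1] \<rho>(2)])
  have L: "1 \<le> L\<^sub>b a \<gamma>" by (rule L\<^sub>b_ge_1[OF a \<gamma>])
  have distinct: "\<exists>f g. optimal a \<gamma> \<delta> f \<and> optimal a \<gamma> \<delta> g \<and> f \<noteq> g" if "0 < \<delta>"
  proof -
    let ?K = "\<lambda>s. max (G s) \<delta>"
    have K: "admissible a \<gamma> \<delta> \<rho> ?K"
      using \<rho>1 \<kappa> by (intro admissible_keep_forever[OF a \<gamma> \<delta> _ _ G]) auto
    obtain T where T: "admissible a \<gamma> \<delta> \<rho> (\<lambda>s. if s < T then ?K s else 0)"
      by (rule admissible_buy_late[OF a \<gamma> \<delta>(1) less_imp_le[OF \<rho>1] \<kappa> K])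
    obtain f g where fg: "optimal a \<gamma> \<delta> f" "survival f = ?K"
        "optimal a \<gamma> \<delta> g" "survival g = (\<lambda>s. if s < T then ?K s else 0)"
      using realise[OF K] realise[OF T] by auto
    \<comment> \<open>At \<open>T\<close> the first function is at least \<open>\<delta>\<close>,
      which is positive, and the second is 0.\<close>
    have "survival f T \<noteq> survival g T" using fg(2,4) that by simp
    then have "f \<noteq> g" by blast
    then show ?thesis using fg(1,3) by blast
  qed
  have exact: "measure f {ennreal (L\<^sub>b a \<gamma>)<..} = \<delta>" if "optimal a \<gamma> \<delta> f" for f
  proof -
    have f: "admissible a \<gamma> \<delta> \<rho> (survival f)" using that opt by simp
    have "\<not> survival f (L\<^sub>b a \<gamma>) < \<delta>"
    proof
      assume less: "survival f (L\<^sub>b a \<gamma>) < \<delta>"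
      obtain r K where r: "1 \<le> r" "r < \<rho>" "admissible a \<gamma> \<delta> r K"
        by (rule admissible_improvable[OF a \<gamma> \<rho>1 \<rho>2 \<kappa> f less])
      have "ennreal \<rho> \<le> ennreal r" using OPT_le[OF a \<gamma> \<delta>(1) r(1,3)] \<rho> by simp
      then show False using r by (simp add: ennreal_le_iff)
    qed
    then have "survival f (L\<^sub>b a \<gamma>) = \<delta>" using f by (simp add: admissible_def tail_ok_def)
    then show ?thesis using L by (simp add: survival_def)
  qed
  show ?thesis using realise[OF G] distinct L exact by blast
qed

end
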